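(* Let $\mu$ be a regular cardinal and let $\mathcal{K}$ be a $\mu$-accessible category all of whose morphisms are monomorphisms. Let $\mathcal{A}$ be a skeleton of the full subcategory of $\mu$-presentable objects of $\mathcal{K}$ and let $\nu = |\mathrm{Mor}(\mathcal{A})|$ be its number of morphisms. Then $\mathcal{K}$ is equivalent (as a category) to a $\mu$-AEC for which $\lambda = \max(\mu,\nu)^{<\mu}$ is a Löwenheim–Skolem–Tarski number.
   Context: For a regular cardinal $\mu$: a poset is $\mu$-directed if every subset of size $<\mu$ has an upper bound; an object $M$ of a category $\mathcal{C}$ is $\mu$-presentable if the hom-functor $\mathcal{C}(M,-)$ preserves colimits of diagrams indexed by $\mu$-directed posets; $\mathcal{C}$ is $\mu$-accessible if it has all $\mu$-directed colimits and has a set $\mathcal{A}$ of $\mu$-presentable objects such that every object is a $\mu$-directed colimit of objects of $\mathcal{A}$. Two categories are equivalent if there is a full, faithful and essentially surjective functor between them. A $\mu$-ary language has function and relation symbols of ordinal arities $<\mu$. A $\mu$-abstract class is a pair $(\mathcal{K}, \le_{\mathcal{K}})$ where $\mathcal{K}$ is a class of $L$-structures for a fixed $\mu$-ary language $L = L(\mathcal{K})$, $\le_{\mathcal{K}}$ is a reflexive and transitive relation on $\mathcal{K}$ such that $M \le_{\mathcal{K}} N$ implies $M$ is an $L$-substructure of $N$, and which respects isomorphisms. It is a $\mu$-AEC if: (Coherence) if $M_0, M_1, M_2 \in \mathcal{K}$, $M_0 \le_{\mathcal{K}} M_2$, $M_1 \le_{\mathcal{K}} M_2$ and $M_0 \subseteq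 M_1$, then $M_0 \le_{\mathcal{K}} M_1$; (Tarski–Vaught) if $\{M_i : i \in I\} \subseteq \mathcal{K}$ with $I$ $\mu$-directed and $i \le j \Rightarrow M_i \le_{\mathcal{K}} M_j$, then (a) $\bigcup_i M_i \in \mathcal{K}$ and $M_j \le_{\mathcal{K}} \bigcup_i M_i$ for all $j$, and (b) if $N \in \mathcal{K}$ with $M_i \le_{\mathcal{K}} N$ for all $i$, then $\bigcup_i M_i \le_{\mathcal{K}} N$; (Löwenheim–Skolem–Tarski) there is a cardinal $\lambda = \lambda^{<\mu} \ge |L(\mathcal{K})| + \mu$ (a Löwenheim–Skolem–Tarski number) such that for every $M \in \mathcal{K}$ and $A \subseteq |M|$ there is $N \le_{\mathcal{K}} M$ with $A \subseteq |N|$ and $|N| \le |A|^{<\mu} + \lambda$. A $\mu$-AEC is regarded as a category whose morphisms $M \to N$ are maps that are $L$-isomorphisms onto some $f[M] \le_{\mathcal{K}} N$. *)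

theory Defs
  imports "HOL-Library.FuncSet"
begin

unbundle cardinal_syntax

section \<open>Size\<close>

text \<open>
  Classes and sets are separated by a cardinal \<open>\<kappa>\<close> that well-orders a whole type \<open>'u\<close>: a set, over
  any type, is small (a "set" of the ambient set theory) if its cardinality is below \<open>\<kappa>\<close>. Every
  small set is in bijection with a small subset of \<open>'u\<close>, so the index posets of diagrams and the
  carriers of structures can be taken to be subsets of \<open>'u\<close> without loss of generality.
\<close>

abbreviation small :: "'u rel \<Rightarrow> 'a set \<Rightarrow> bool" where
  "small \<kappa> A \<equiv> |A| <o \<kappa>"

text \<open>Infinite regular cardinals. A cardinal is a minimal well-order, and the ordinals below it
  are its elements \<open>\<alpha>\<close>, with \<open>underS \<mu> \<alpha>\<close> the set of ordinals below \<open>\<alpha>\<close>.\<close>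

definition regular_cardinal :: "'k rel \<Rightarrow> bool" where
  "regular_cardinal \<mu> \<longleftrightarrow> Card_order \<mu> \<and> cinfinite \<mu> \<and> regularCard \<mu>"

definition tuples :: "'k rel \<Rightarrow> 'k \<Rightarrow> 'a set \<Rightarrow> ('k \<Rightarrow> 'a) set" where
  "tuples \<mu> \<alpha> X = underS \<mu> \<alpha> \<rightarrow>\<^sub>E X"

text \<open>\<open>r\<close> to the power \<open><\<mu>\<close>: the number of sequences in \<open>r\<close> of ordinal length \<open><\<mu>\<close>. (This is the
  supremum of the powers with exponent \<open><\<mu>\<close> as soon as \<open>r\<close> has at least two elements.)\<close>

definition pow_less :: "'a rel \<Rightarrow> 'k rel \<Rightarrow> ('k \<times> ('k \<Rightarrow> 'a)) rel" where
  "pow_less r \<mu> = |SIGMA \<alpha>:Field \<mu>. tuples \<mu> \<alpha> (Field r)|"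

definition card_max :: "'a rel \<Rightarrow> 'b rel \<Rightarrow> ('a + 'b) rel" where
  "card_max r s = (if r \<le>o s then |Inr ` Field s| else |Inl ` Field r| )"

text \<open>
  What is used of the ambient universe: unions of small families of small sets are small
  (regularity), \<open>\<mu>\<close> is small, and \<open>|X|\<close> to the power \<open><\<mu>\<close> is small for small \<open>X\<close>. Every strongly
  inaccessible \<open>\<kappa> > \<mu>\<close> qualifies, but so does for instance the first uncountable cardinal when
  \<open>\<mu>\<close> is countable.
\<close>

definition universe_for :: "'u rel \<Rightarrow> 'k rel \<Rightarrow> bool" where
  "universe_for \<kappa> \<mu> \<longleftrightarrow>
     card_order \<kappa> \<and> regular_cardinal \<kappa> \<and> \<mu> <o \<kappa> \<and>
     (\<forall>X :: 'u set. small \<kappa> X \<longrightarrow> pow_less (card_of X) \<mu> <o \<kappa>)"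


section \<open>Categories\<close>

record ('o, 'm) cat =
  Obj :: "'o set"
  Arr :: "'m set"
  Dom :: "'m \<Rightarrow> 'o"
  Cod :: "'m \<Rightarrow> 'o"
  Id :: "'o \<Rightarrow> 'm"
  Comp :: "'m \<Rightarrow> 'm \<Rightarrow> 'm"  \<comment> \<open>\<open>Comp C g f\<close> is \<open>g\<close> after \<open>f\<close>\<close>

definition Hom :: "('o, 'm) cat \<Rightarrow> 'o \<Rightarrow> 'o \<Rightarrow> 'm set" where
  "Hom C x y = {f \<in> Arr C. Dom C f = x \<and> Cod C f = y}"

definition category :: "('o, 'm) cat \<Rightarrow> bool" where
  "category C \<longleftrightarrow>
     (\<forall>f\<in>Arr C. Dom C f \<in> Obj C \<and> Cod C f \<in> Obj C) \<and>
     (\<forall>x\<in>Obj C. Id C x \<in> Hom C x x) \<and>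
     (\<forall>f\<in>Arr C. \<forall>g\<in>Arr C. Dom C g = Cod C f \<longrightarrow> Comp C g f \<in> Hom C (Dom C f) (Cod C g)) \<and>
     (\<forall>f\<in>Arr C. Comp C f (Id C (Dom C f)) = f \<and> Comp C (Id C (Cod C f)) f = f) \<and>
     (\<forall>f\<in>Arr C. \<forall>g\<in>Arr C. \<forall>h\<in>Arr C. Dom C g = Cod C f \<longrightarrow> Dom C h = Cod C g \<longrightarrow>
        Comp C h (Comp C g f) = Comp C (Comp C h g) f)"

definition locally_small :: "'u rel \<Rightarrow> ('o, 'm) cat \<Rightarrow> bool" where
  "locally_small \<kappa> C \<longleftrightarrow> (\<forall>x\<in>Obj C. \<forall>y\<in>Obj C. small \<kappa> (Hom C x y))"

definition monomorphism :: "('o, 'm) cat \<Rightarrow> 'm \<Rightarrow> bool" where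
  "monomorphism C f \<longleftrightarrow> f \<in> Arr C \<and>
     (\<forall>g\<in>Arr C. \<forall>h\<in>Arr C. Dom C g = Dom C h \<longrightarrow> Cod C g = Dom C f \<longrightarrow> Cod C h = Dom C f \<longrightarrow>
        Comp C f g = Comp C f h \<longrightarrow> g = h)"

definition isomorphic_objects :: "('o, 'm) cat \<Rightarrow> 'o \<Rightarrow> 'o \<Rightarrow> bool" where
  "isomorphic_objects C x y \<longleftrightarrow>
     (\<exists>f\<in>Hom C x y. \<exists>g\<in>Hom C y x. Comp C g f = Id C x \<and> Comp C f g = Id C y)"

definition full_subcategory :: "('o, 'm) cat \<Rightarrow> 'o set \<Rightarrow> ('o, 'm) cat" where
  "full_subcategory C S = C\<lparr>Obj := S, Arr := {f \<in> Arr C. Dom C f \<in> S \<and> Cod C f \<in> S}\<rparr>"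

definition skeleton_of :: "('o, 'm) cat \<Rightarrow> ('o, 'm) cat \<Rightarrow> bool" where
  "skeleton_of A C \<longleftrightarrow>
     (\<exists>S\<subseteq>Obj C. A = full_subcategory C S \<and> (\<forall>x\<in>Obj C. \<exists>!s. s \<in> S \<and> isomorphic_objects C x s))"

definition is_functor ::
  "('o, 'm) cat \<Rightarrow> ('p, 'n) cat \<Rightarrow> ('o \<Rightarrow> 'p) \<Rightarrow> ('m \<Rightarrow> 'n) \<Rightarrow> bool" where
  "is_functor C D F\<^sub>0 F\<^sub>1 \<longleftrightarrow>
     (\<forall>x\<in>Obj C. F\<^sub>0 x \<in> Obj D) \<and>
     (\<forall>f\<in>Arr C. F\<^sub>1 f \<in> Hom D (F\<^sub>0 (Dom C f)) (F\<^sub>0 (Cod C f))) \<and>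
     (\<forall>x\<in>Obj C. F\<^sub>1 (Id C x) = Id D (F\<^sub>0 x)) \<and>
     (\<forall>f\<in>Arr C. \<forall>g\<in>Arr C. Dom C g = Cod C f \<longrightarrow> F\<^sub>1 (Comp C g f) = Comp D (F\<^sub>1 g) (F\<^sub>1 f))"

definition equivalent_categories :: "('o, 'm) cat \<Rightarrow> ('p, 'n) cat \<Rightarrow> bool" where
  "equivalent_categories C D \<longleftrightarrow> (\<exists>F\<^sub>0 F\<^sub>1. is_functor C D F\<^sub>0 F\<^sub>1 \<and>
     (\<forall>x\<in>Obj C. \<forall>y\<in>Obj C. inj_on F\<^sub>1 (Hom C x y)) \<and>
     (\<forall>x\<in>Obj C. \<forall>y\<in>Obj C. Hom D (F\<^sub>0 x) (F\<^sub>0 y) \<subseteq> F\<^sub>1 ` Hom C x y) \<and>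
     (\<forall>z\<in>Obj D. \<exists>x\<in>Obj C. isomorphic_objects D (F\<^sub>0 x) z))"


section \<open>Directed colimits and accessible categories\<close>

definition directed_poset :: "'k rel \<Rightarrow> 'i set \<Rightarrow> 'i rel \<Rightarrow> bool" where
  "directed_poset \<mu> I r \<longleftrightarrow> r \<subseteq> I \<times> I \<and> partial_order_on I r \<and>
     (\<forall>X\<subseteq>I. |X| <o \<mu> \<longrightarrow> (\<exists>b\<in>I. \<forall>x\<in>X. (x, b) \<in> r))"

definition diagram ::
  "('o, 'm) cat \<Rightarrow> 'i set \<Rightarrow> 'i rel \<Rightarrow> ('i \<Rightarrow> 'o) \<Rightarrow> ('i \<Rightarrow> 'i \<Rightarrow> 'm) \<Rightarrow> bool" where
  "diagram C I r D\<^sub>0 D\<^sub>1 \<longleftrightarrow>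
     (\<forall>i\<in>I. D\<^sub>0 i \<in> Obj C \<and> D\<^sub>1 i i = Id C (D\<^sub>0 i)) \<and>
     (\<forall>i j. (i, j) \<in> r \<longrightarrow> D\<^sub>1 i j \<in> Hom C (D\<^sub>0 i) (D\<^sub>0 j)) \<and>
     (\<forall>i j k. (i, j) \<in> r \<longrightarrow> (j, k) \<in> r \<longrightarrow> D\<^sub>1 i k = Comp C (D\<^sub>1 j k) (D\<^sub>1 i j))"

definition cocone ::
  "('o, 'm) cat \<Rightarrow> 'i set \<Rightarrow> 'i rel \<Rightarrow> ('i \<Rightarrow> 'o) \<Rightarrow> ('i \<Rightarrow> 'i \<Rightarrow> 'm) \<Rightarrow> 'o \<Rightarrow> ('i \<Rightarrow> 'm) \<Rightarrow> bool"
where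
  "cocone C I r D\<^sub>0 D\<^sub>1 c \<phi> \<longleftrightarrow> c \<in> Obj C \<and> (\<forall>i\<in>I. \<phi> i \<in> Hom C (D\<^sub>0 i) c) \<and>
     (\<forall>i j. (i, j) \<in> r \<longrightarrow> Comp C (\<phi> j) (D\<^sub>1 i j) = \<phi> i)"

definition colimit ::
  "('o, 'm) cat \<Rightarrow> 'i set \<Rightarrow> 'i rel \<Rightarrow> ('i \<Rightarrow> 'o) \<Rightarrow> ('i \<Rightarrow> 'i \<Rightarrow> 'm) \<Rightarrow> 'o \<Rightarrow> ('i \<Rightarrow> 'm) \<Rightarrow> bool"
where
  "colimit C I r D\<^sub>0 D\<^sub>1 c \<phi> \<longleftrightarrow> cocone C I r D\<^sub>0 D\<^sub>1 c \<phi> \<and>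
     (\<forall>d \<psi>. cocone C I r D\<^sub>0 D\<^sub>1 d \<psi> \<longrightarrow> (\<exists>!u. u \<in> Hom C c d \<and> (\<forall>i\<in>I. Comp C u (\<phi> i) = \<psi> i)))"

definition preserves_directed_colimits ::
  "'u rel \<Rightarrow> 'k rel \<Rightarrow> ('o, 'm) cat \<Rightarrow> ('p, 'n) cat \<Rightarrow> ('o \<Rightarrow> 'p) \<Rightarrow> ('m \<Rightarrow> 'n) \<Rightarrow> bool" where
  "preserves_directed_colimits \<kappa> \<mu> C D F\<^sub>0 F\<^sub>1 \<longleftrightarrow>
     (\<forall>(I :: 'u set) r D\<^sub>0 D\<^sub>1 c \<phi>.
        small \<kappa> I \<longrightarrow> directed_poset \<mu> I r \<longrightarrow> diagram C I r D\<^sub>0 D\<^sub>1 \<longrightarrow> colimit C I r D\<^sub>0 D\<^sub>1 c \<phi> \<longrightarrow>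
        colimit D I r (\<lambda>i. F\<^sub>0 (D\<^sub>0 i)) (\<lambda>i j. F\<^sub>1 (D\<^sub>1 i j)) (F\<^sub>0 c) (\<lambda>i. F\<^sub>1 (\<phi> i)))"

definition set_cat :: "'u rel \<Rightarrow> ('a set, 'a set \<times> ('a \<Rightarrow> 'a) \<times> 'a set) cat" where
  "set_cat \<kappa> = \<lparr>
     Obj = {X. small \<kappa> X},
     Arr = {(X, f, Y). small \<kappa> X \<and> small \<kappa> Y \<and> f \<in> X \<rightarrow>\<^sub>E Y},
     Dom = (\<lambda>(X, f, Y). X),
     Cod = (\<lambda>(X, f, Y). Y),
     Id = (\<lambda>X. (X, \<lambda>x\<in>X. x, X)),
     Comp = (\<lambda>(Y, g, Z) (X, f, Y'). (X, compose X g f, Z))\<rparr>"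

text \<open>The hom-functor \<open>C(M,-)\<close> takes values in the small subsets of \<open>'m + 'u\<close> rather than of the type
  \<open>'m\<close> of arrows, because the latter may be too small a type to contain a copy of every small set.\<close>

definition hom_obj :: "('o, 'm) cat \<Rightarrow> 'o \<Rightarrow> 'o \<Rightarrow> ('m + 'u) set" where
  "hom_obj C M x = Inl ` Hom C M x"

definition hom_arr ::
  "('o, 'm) cat \<Rightarrow> 'o \<Rightarrow> 'm \<Rightarrow> ('m + 'u) set \<times> ('m + 'u \<Rightarrow> 'm + 'u) \<times> ('m + 'u) set" where
  "hom_arr C M g =
     (hom_obj C M (Dom C g),
      \<lambda>z\<in>hom_obj C M (Dom C g). Inl (Comp C g (projl z)),
      hom_obj C M (Cod C g))"

definition presentable :: "'u rel \<Rightarrow> 'k rel \<Rightarrow> ('o, 'm) cat \<Rightarrow> 'o \<Rightarrow> bool" where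
  "presentable \<kappa> \<mu> C M \<longleftrightarrow> M \<in> Obj C \<and>
     preserves_directed_colimits \<kappa> \<mu> C (set_cat \<kappa> :: (('m + 'u) set, _) cat) (hom_obj C M) (hom_arr C M)"

definition accessible :: "'u rel \<Rightarrow> 'k rel \<Rightarrow> ('o, 'm) cat \<Rightarrow> bool" where
  "accessible \<kappa> \<mu> C \<longleftrightarrow> category C \<and> locally_small \<kappa> C \<and>
     (\<forall>(I :: 'u set) r D\<^sub>0 D\<^sub>1.
        small \<kappa> I \<longrightarrow> directed_poset \<mu> I r \<longrightarrow> diagram C I r D\<^sub>0 D\<^sub>1 \<longrightarrow> (\<exists>c \<phi>. colimit C I r D\<^sub>0 D\<^sub>1 c \<phi>)) \<and>
     (\<exists>\<A>. small \<kappa> \<A> \<and> (\<forall>M\<in>\<A>. presentable \<kappa> \<mu> C M) \<and>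
        (\<forall>x\<in>Obj C. \<exists>(I :: 'u set) r D\<^sub>0 D\<^sub>1 \<phi>.
           small \<kappa> I \<and> directed_poset \<mu> I r \<and> diagram C I r D\<^sub>0 D\<^sub>1 \<and> D\<^sub>0 ` I \<subseteq> \<A> \<and>
           colimit C I r D\<^sub>0 D\<^sub>1 x \<phi>))"


section \<open>Languages and structures\<close>

text \<open>An arity is an ordinal below \<open>\<mu>\<close>, that is, an element of \<open>Field \<mu>\<close>.\<close>

record ('s, 'k) language =
  fun_syms :: "'s set"
  rel_syms :: "'s set"
  fun_arity :: "'s \<Rightarrow> 'k"
  rel_arity :: "'s \<Rightarrow> 'k"

definition is_language :: "'u rel \<Rightarrow> 'k rel \<Rightarrow> ('s, 'k) language \<Rightarrow> bool" where
  "is_language \<kappa> \<mu> L \<longleftrightarrow> small \<kappa> (fun_syms L) \<and> small \<kappa> (rel_syms L) \<and>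
     fun_arity L ` fun_syms L \<subseteq> Field \<mu> \<and> rel_arity L ` rel_syms L \<subseteq> Field \<mu>"

definition language_card :: "('s, 'k) language \<Rightarrow> ('s + 's) rel" where
  "language_card L = |fun_syms L <+> rel_syms L|"

record ('s, 'k, 'a) struct =
  carrier :: "'a set"
  fun_int :: "'s \<Rightarrow> ('k \<Rightarrow> 'a) \<Rightarrow> 'a"
  rel_int :: "'s \<Rightarrow> ('k \<Rightarrow> 'a) set"

text \<open>Interpretations are extensional, so that a structure is determined by its carrier and by the
  values of the symbols of the language on tuples from the carrier.\<close>

definition is_struct :: "'u rel \<Rightarrow> 'k rel \<Rightarrow> ('s, 'k) language \<Rightarrow> ('s, 'k, 'a) struct \<Rightarrow> bool" where
  "is_struct \<kappa> \<mu> L M \<longleftrightarrow> small \<kappa> (carrier M) \<and>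
     fun_int M \<in> (\<Pi>\<^sub>E f\<in>fun_syms L. tuples \<mu> (fun_arity L f) (carrier M) \<rightarrow>\<^sub>E carrier M) \<and>
     rel_int M \<in> (\<Pi>\<^sub>E R\<in>rel_syms L. Pow (tuples \<mu> (rel_arity L R) (carrier M)))"

definition substruct ::
  "'k rel \<Rightarrow> ('s, 'k) language \<Rightarrow> ('s, 'k, 'a) struct \<Rightarrow> ('s, 'k, 'a) struct \<Rightarrow> bool" where
  "substruct \<mu> L M N \<longleftrightarrow> carrier M \<subseteq> carrier N \<and>
     (\<forall>f\<in>fun_syms L. \<forall>x\<in>tuples \<mu> (fun_arity L f) (carrier M). fun_int M f x = fun_int N f x) \<and>
     (\<forall>R\<in>rel_syms L. rel_int M R = rel_int N R \<inter> tuples \<mu> (rel_arity L R) (carrier M))"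

definition struct_iso ::
  "'k rel \<Rightarrow> ('s, 'k) language \<Rightarrow> ('a \<Rightarrow> 'b) \<Rightarrow> ('s, 'k, 'a) struct \<Rightarrow> ('s, 'k, 'b) struct \<Rightarrow> bool" where
  "struct_iso \<mu> L h M N \<longleftrightarrow> bij_betw h (carrier M) (carrier N) \<and>
     (\<forall>f\<in>fun_syms L. \<forall>x\<in>tuples \<mu> (fun_arity L f) (carrier M).
        h (fun_int M f x) = fun_int N f (compose (underS \<mu> (fun_arity L f)) h x)) \<and>
     (\<forall>R\<in>rel_syms L. \<forall>x\<in>tuples \<mu> (rel_arity L R) (carrier M).
        x \<in> rel_int M R \<longleftrightarrow> compose (underS \<mu> (rel_arity L R)) h x \<in> rel_int N R)"

text \<open>For a \<open>\<mu>\<close>-directed system of structures and extensions, every tuple of length \<open><\<mu>\<close> from the union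
  of the carriers lies in some member of the system, and any two members containing it agree on the
  value of a function symbol there.\<close>

definition union_struct ::
  "'k rel \<Rightarrow> ('s, 'k) language \<Rightarrow> 'i set \<Rightarrow> ('i \<Rightarrow> ('s, 'k, 'a) struct) \<Rightarrow> ('s, 'k, 'a) struct" where
  "union_struct \<mu> L I M = \<lparr>
     carrier = (\<Union>i\<in>I. carrier (M i)),
     fun_int = (\<lambda>f\<in>fun_syms L. \<lambda>x\<in>tuples \<mu> (fun_arity L f) (\<Union>i\<in>I. carrier (M i)).
        THE y. \<exists>i\<in>I. x \<in> tuples \<mu> (fun_arity L f) (carrier (M i)) \<and> y = fun_int (M i) f x),
     rel_int = (\<lambda>R\<in>rel_syms L. \<Union>i\<in>I. rel_int (M i) R)\<rparr>"


section \<open>Abstract elementary classes of infinitary arity\<close>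

definition abstract_class ::
  "'u rel \<Rightarrow> 'k rel \<Rightarrow> ('s, 'k) language \<Rightarrow> ('s, 'k, 'a) struct set \<Rightarrow>
   (('s, 'k, 'a) struct \<Rightarrow> ('s, 'k, 'a) struct \<Rightarrow> bool) \<Rightarrow> bool" where
  "abstract_class \<kappa> \<mu> L \<K> le \<longleftrightarrow>
     is_language \<kappa> \<mu> L \<and>
     (\<forall>M\<in>\<K>. is_struct \<kappa> \<mu> L M) \<and>
     (\<forall>M N. le M N \<longrightarrow> M \<in> \<K> \<and> N \<in> \<K> \<and> substruct \<mu> L M N) \<and>
     (\<forall>M\<in>\<K>. le M M) \<and>
     (\<forall>M N P. le M N \<longrightarrow> le N P \<longrightarrow> le M P) \<and>
     (\<forall>M N h. M \<in> \<K> \<longrightarrow> is_struct \<kappa> \<mu> L N \<longrightarrow> struct_iso \<mu> L h M N \<longrightarrow> N \<in> \<K>) \<and>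
     (\<forall>M N M' N' h. le M N \<longrightarrow> is_struct \<kappa> \<mu> L M' \<longrightarrow> is_struct \<kappa> \<mu> L N' \<longrightarrow>
        struct_iso \<mu> L h N N' \<longrightarrow> struct_iso \<mu> L h M M' \<longrightarrow> le M' N')"

text \<open>\<open>l\<close> is a Loewenheim-Skolem-Tarski number of the class.\<close>

definition LST_number ::
  "'u rel \<Rightarrow> 'k rel \<Rightarrow> ('s, 'k) language \<Rightarrow> ('s, 'k, 'a) struct set \<Rightarrow>
   (('s, 'k, 'a) struct \<Rightarrow> ('s, 'k, 'a) struct \<Rightarrow> bool) \<Rightarrow> 'l rel \<Rightarrow> bool" where
  "LST_number \<kappa> \<mu> L \<K> le l \<longleftrightarrow>
     Card_order l \<and> l <o \<kappa> \<and> l =o pow_less l \<mu> \<and> language_card L +c \<mu> \<le>o l \<and>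
     (\<forall>M\<in>\<K>. \<forall>A\<subseteq>carrier M. \<exists>N. le N M \<and> A \<subseteq> carrier N \<and> |carrier N| \<le>o pow_less (card_of A) \<mu> +c l)"

definition mu_AEC ::
  "'u rel \<Rightarrow> 'k rel \<Rightarrow> ('s, 'k) language \<Rightarrow> ('s, 'k, 'a) struct set \<Rightarrow>
   (('s, 'k, 'a) struct \<Rightarrow> ('s, 'k, 'a) struct \<Rightarrow> bool) \<Rightarrow> bool" where
  "mu_AEC \<kappa> \<mu> L \<K> le \<longleftrightarrow>
     abstract_class \<kappa> \<mu> L \<K> le \<and>
     \<comment> \<open>Coherence\<close>
     (\<forall>M\<^sub>0 M\<^sub>1 M\<^sub>2. le M\<^sub>0 M\<^sub>2 \<longrightarrow> le M\<^sub>1 M\<^sub>2 \<longrightarrow> substruct \<mu> L M\<^sub>0 M\<^sub>1 \<longrightarrow> le M\<^sub>0 M\<^sub>1) \<and>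
     \<comment> \<open>Tarski-Vaught\<close>
     (\<forall>(I :: 'u set) r M. small \<kappa> I \<longrightarrow> directed_poset \<mu> I r \<longrightarrow> (\<forall>i\<in>I. M i \<in> \<K>) \<longrightarrow>
        (\<forall>i j. (i, j) \<in> r \<longrightarrow> le (M i) (M j)) \<longrightarrow>
        union_struct \<mu> L I M \<in> \<K> \<and>
        (\<forall>j\<in>I. le (M j) (union_struct \<mu> L I M)) \<and>
        (\<forall>N\<in>\<K>. (\<forall>i\<in>I. le (M i) N) \<longrightarrow> le (union_struct \<mu> L I M) N)) \<and>
     \<comment> \<open>Loewenheim-Skolem-Tarski\<close>
     (\<exists>l :: 'u rel. LST_number \<kappa> \<mu> L \<K> le l)"

definition AEC_cat ::
  "'k rel \<Rightarrow> ('s, 'k) language \<Rightarrow> ('s, 'k, 'a) struct set \<Rightarrow>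
   (('s, 'k, 'a) struct \<Rightarrow> ('s, 'k, 'a) struct \<Rightarrow> bool) \<Rightarrow>
   (('s, 'k, 'a) struct, ('s, 'k, 'a) struct \<times> ('a \<Rightarrow> 'a) \<times> ('s, 'k, 'a) struct) cat" where
  "AEC_cat \<mu> L \<K> le = \<lparr>
     Obj = \<K>,
     Arr = {(M, h, N). M \<in> \<K> \<and> N \<in> \<K> \<and> h \<in> extensional (carrier M) \<and>
              (\<exists>M'. le M' N \<and> struct_iso \<mu> L h M M')},
     Dom = (\<lambda>(M, h, N). M),
     Cod = (\<lambda>(M, h, N). N),
     Id = (\<lambda>M. (M, \<lambda>x\<in>carrier M. x, M)),
     Comp = (\<lambda>(N, h', P) (M, h, N'). (M, compose (carrier M) h' h, P))\<rparr>"

end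

theory Submission
  imports Defs
begin

text \<open>
  An object \<open>x\<close> is turned into the structure of all arrows \<open>a \<rightarrow> x\<close> with \<open>a\<close> in the skeleton, with one
  binary relation for each arrow \<open>g\<close> of the skeleton, relating \<open>f\<close> to \<open>f \<circ> g\<close>. Since the skeleton is
  dense, its natural transformations are exactly the arrows between objects; since all arrows are
  monomorphisms, these are the same as the embeddings of structures. The class consists of the
  structures isomorphic to such a structure, ordered by the substructure relation, so that coherence
  is trivial. Presentability says that the structure of a directed colimit is the union of the
  structures, which gives the Tarski-Vaught axioms. For the Loewenheim-Skolem-Tarski axiom, write
  \<open>x\<close> as a directed colimit of members of the skeleton and pass to a directed subset of the index poset
  through which all given elements factor; its size is controlled since \<open>\<beta>\<close> to the power \<open><\<mu>\<close> is
  idempotent for regular \<open>\<mu>\<close>.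
\<close>

section \<open>Powers below a regular cardinal\<close>

text \<open>Two demands shape the argument. Embeddings reflect relations, whereas naturality only
  says that relations are preserved; reflection is what left cancellation gives, since
  \<open>f\<close> is recovered from \<open>Comp C u f\<close>. The constant \<lambda> must be at
  least \<mu>, because closing a set of indices under bounds takes \<mu> rounds; at least \<nu>,
  because \<nu> counts the symbols and is also the factor by which the structure of a colimit of
  members of the skeleton can outgrow the index poset; and stable under powers <\<mu>, because each
  round adds a bound for every subset of size <\<mu>. The maximum of \<mu> and \<nu> meets the first
  two demands, and passing to its power <\<mu> adds the third. For an arbitrary subset of a
  structure, the sum of its own power <\<mu> and \<lambda> inherits all three.\<close>

definition psub :: "'k rel \<Rightarrow> 'a set \<Rightarrow> 'a set set" where
  "psub \<mu> X = {Y. Y \<subseteq> X \<and> |Y| <o \<mu>}"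

lemma psub_mono:
  assumes "|X| \<le>o |Y|" shows "|psub \<mu> X| \<le>o |psub \<mu> Y|"
proof -
  obtain f where f: "inj_on f X" "f ` X \<subseteq> Y" using assms unfolding card_of_ordLeq[symmetric] by auto
  show ?thesis
  proof (rule card_of_ordLeqI)
    show "inj_on ((`) f) (psub \<mu> X)"
    proof (rule inj_onI)
      fix U V assume "U \<in> psub \<mu> X" "V \<in> psub \<mu> X" "f ` U = f ` V"
      then show "U = V" using inj_on_image_eq_iff[OF f(1), of U V] by (simp add: psub_def)
    qed
    show "f ` Z \<in> psub \<mu> Y" if "Z \<in> psub \<mu> X" for Z
    proof -
      have "Z \<subseteq> X" "|Z| <o \<mu>" using that by (auto simp: psub_def)
      moreover have "|f ` Z| <o \<mu>" by (rule ordLeq_ordLess_trans[OF card_of_image \<open>|Z| <o \<mu>\<close>])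
      ultimately show ?thesis using f(2) by (auto simp: psub_def)
    qed
  qed
qed
lemma tuples_card_mono:
  assumes "|X| \<le>o |Y|"
  shows "|tuples \<mu> \<alpha> X| \<le>o |tuples \<mu> \<alpha> Y|"
proof -
  obtain f where f: "inj_on f X" "f ` X \<subseteq> Y" using assms unfolding card_of_ordLeq[symmetric] by auto
  show ?thesis
  proof (rule card_of_ordLeqI)
    show "inj_on (compose (underS \<mu> \<alpha>) f) (tuples \<mu> \<alpha> X)"
    proof (rule inj_onI)
      fix s t assume s: "s \<in> tuples \<mu> \<alpha> X" and t: "t \<in> tuples \<mu> \<alpha> X"
        and eq: "compose (underS \<mu> \<alpha>) f s = compose (underS \<mu> \<alpha>) f t"
      show "s = t"
      proof (rule PiE_ext[OF s[unfolded tuples_def] t[unfolded tuples_def]])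
        fix i assume i: "i \<in> underS \<mu> \<alpha>"
        with fun_cong[OF eq, of i] have "f (s i) = f (t i)" by (simp add: compose_def)
        moreover have "s i \<in> X" "t i \<in> X" using s t i by (auto simp: tuples_def)
        ultimately show "s i = t i" using f(1) by (auto dest: inj_onD)
      qed
    qed
    show "compose (underS \<mu> \<alpha>) f t \<in> tuples \<mu> \<alpha> Y" if "t \<in> tuples \<mu> \<alpha> X" for t
      using that f(2) by (auto simp: tuples_def compose_def)
  qed
qed

lemma pow_less_mono:
  assumes "r \<le>o s" shows "pow_less r \<mu> \<le>o pow_less s \<mu>"
  unfolding pow_less_def
  by (rule card_of_Sigma_mono1) (simp add: tuples_card_mono card_of_mono2[OF assms])

lemma pow_less_cong:
  assumes "r =o s" shows "pow_less r \<mu> =o pow_less s \<mu>"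
  using assms by (simp add: ordIso_iff_ordLeq pow_less_mono)

lemma Card_order_pow_less: "Card_order (pow_less r \<mu>)"
  by (simp add: pow_less_def card_of_Card_order)

lemma Card_order_card_max: "Card_order (card_max r s)"
  by (simp add: card_max_def card_of_Card_order)

text \<open>The sum type merely tags the larger cardinal, and cardinals are comparable; all later
  bounds follow by these two cases.\<close>

lemma card_max_cases:
  fixes r :: "'a rel" and s :: "'b rel"
  assumes r: "Card_order r" and s: "Card_order s"
  shows "(r \<le>o s \<and> card_max r s =o s) \<or> (s \<le>o r \<and> card_max r s =o r)"
proof -
  let ?l = "Inl ` Field r :: ('a + 'b) set" and ?r = "Inr ` Field s :: ('a + 'b) set"
  have l: "|?l| =o |Field r|" and r: "|?r| =o |Field s|"
    by (auto intro!: ordIso_symmetric card_of_ordIsoI[of Inl] card_of_ordIsoI[of Inr] simp: bij_betw_def)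
  have "r \<le>o s \<or> s \<le>o r"
    using assms by (intro ordLeq_total) (auto dest: card_order_on_well_order_on)
  then show ?thesis
    using ordIso_transitive[OF l card_of_Field_ordIso[OF assms(1)]]
      ordIso_transitive[OF r card_of_Field_ordIso[OF assms(2)]]
    by (auto simp: card_max_def)
qed

lemma card_max_upper:
  assumes "Card_order r" "Card_order s"
  shows "r \<le>o card_max r s" "s \<le>o card_max r s"
  using card_max_cases[OF assms] ordLeq_ordIso_trans[OF _ ordIso_symmetric]
    ordIso_imp_ordLeq[OF ordIso_symmetric]
  by metis+

lemma card_max_less:
  assumes "Card_order r" "Card_order s" "r <o k" "s <o k"
  shows "card_max r s <o k"
  using card_max_cases[OF assms(1,2)] ordIso_ordLess_trans[OF _ assms(3)] ordIso_ordLess_trans[OF _ assms(4)]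
  by metis

section \<open>Idempotence of the power below a fixed regular cardinal\<close>

locale regular_card =
  fixes \<mu> :: "'k rel"
  assumes regular: "regular_cardinal \<mu>"
begin

lemma Cinfinite_mu: "Cinfinite \<mu>" and regularCard_mu: "regularCard \<mu>" and Card_order_mu: "Card_order \<mu>"
  and infinite_Field_mu: "\<not> finite (Field \<mu>)"
  using regular by (auto simp: regular_cardinal_def cinfinite_def)

lemma stable_mu: "stable \<mu>"
  using Card_order_mu infinite_Field_mu regularCard_mu by (rule regularCard_stable)

lemma less_above:
  assumes "\<alpha> \<in> Field \<mu>" obtains \<beta> where "\<beta> \<in> Field \<mu>" "\<alpha> \<in> underS \<mu> \<beta>"
  using infinite_Card_order_limit[OF Card_order_mu infinite_Field_mu assms] by (auto simp: underS_def)

lemma finite_less: "finite X \<Longrightarrow> |X| <o \<mu>"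
  using Cfinite_ordLess_Cinfinite[OF _ Cinfinite_mu, of "|X|"] by (simp add: cfinite_def card_of_card_order_on Field_card_of)

text \<open>A well-order strictly below \<mu> is isomorphic to a proper initial segment of \<mu>.
  This turns a cardinality <\<mu> into an arity.\<close>

lemma length_exists:
  assumes "|B| <o \<mu>"
  obtains \<alpha> f where "\<alpha> \<in> Field \<mu>" "bij_betw f (underS \<mu> \<alpha>) B"
proof -
  have W: "Well_order \<mu>" using Card_order_mu card_order_on_well_order_on by blast
  obtain \<alpha> where a: "\<alpha> \<in> Field \<mu>" "|B| =o Restr \<mu> (underS \<mu> \<alpha>)"
    using ordLess_iff_ordIso_Restr[OF W card_of_Well_order] assms by blast
  have "Field (Restr \<mu> (underS \<mu> \<alpha>)) = underS \<mu> \<alpha>"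
    using W by (simp add: wo_rel.underS_ofilter wo_rel_def Field_Restr_ofilter)
  then have "|underS \<mu> \<alpha>| =o |B|"
    using card_of_cong[OF a(2)] by (simp add: Field_card_of ordIso_symmetric)
  then show thesis using a(1) that card_of_ordIso by blast
qed

text \<open>Every set of size <\<mu> is the range of a sequence of length <\<mu>, so sending a
  sequence to its range is a surjection that covers \<open>psub \<mu> X\<close>.\<close>

lemma psub_le_pow_less: "|psub \<mu> X| \<le>o pow_less (card_of X) \<mu>"
  unfolding pow_less_def Field_card_of
proof (rule surj_imp_ordLeq[where f = "\<lambda>(\<alpha>, t). t ` underS \<mu> \<alpha>"], rule subsetI)
  fix Y assume "Y \<in> psub \<mu> X"
  then have Y: "Y \<subseteq> X" "|Y| <o \<mu>" by (auto simp: psub_def)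
  obtain \<alpha> f where f: "\<alpha> \<in> Field \<mu>" "bij_betw f (underS \<mu> \<alpha>) Y"
    using length_exists[OF Y(2)] .
  have "restrict f (underS \<mu> \<alpha>) \<in> tuples \<mu> \<alpha> X" "restrict f (underS \<mu> \<alpha>) ` underS \<mu> \<alpha> = Y"
    using f(2) Y(1) by (auto simp: tuples_def bij_betw_def)
  then show "Y \<in> (\<lambda>(\<alpha>, t). t ` underS \<mu> \<alpha>) ` (SIGMA \<alpha>:Field \<mu>. tuples \<mu> \<alpha> X)"
    using f(1) by (intro image_eqI[where x = "(\<alpha>, restrict f (underS \<mu> \<alpha>))"]) auto
qed

text \<open>A sequence of small sets is coded by the disjoint union of its terms, which is small by
  regularity of \<open>\<mu>\<close>.\<close>

lemma tuples_of_psub: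
  "|SIGMA \<alpha>:Field \<mu>. tuples \<mu> \<alpha> (psub \<mu> X)| \<le>o |Field \<mu> \<times> psub \<mu> (Field \<mu> \<times> X)|"
proof (rule card_of_ordLeqI)
  \<comment> \<open>The length \<open>\<alpha>\<close> is recorded separately, because empty terms
    leave no trace in the disjoint union.\<close>
  let ?f = "\<lambda>(\<alpha>, t). (\<alpha>, SIGMA \<beta>:underS \<mu> \<alpha>. t \<beta>)"
  show "inj_on ?f (SIGMA \<alpha>:Field \<mu>. tuples \<mu> \<alpha> (psub \<mu> X))"
  proof (rule inj_onI, clarsimp)
    fix \<alpha> s t
    assume s: "s \<in> tuples \<mu> \<alpha> (psub \<mu> X)" and t: "t \<in> tuples \<mu> \<alpha> (psub \<mu> X)"
      and eq: "Sigma (underS \<mu> \<alpha>) s = Sigma (underS \<mu> \<alpha>) t"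
    show "s = t"
    proof (rule PiE_ext[OF s[unfolded tuples_def] t[unfolded tuples_def]])
      fix i assume "i \<in> underS \<mu> \<alpha>"
      then have "s i = Sigma (underS \<mu> \<alpha>) s `` {i}" "t i = Sigma (underS \<mu> \<alpha>) t `` {i}"
        by auto
      then show "s i = t i" by (metis eq)
    qed
  qed
  fix a assume "a \<in> (SIGMA \<alpha>:Field \<mu>. tuples \<mu> \<alpha> (psub \<mu> X))"
  then obtain \<alpha> t where a: "a = (\<alpha>, t)" "\<alpha> \<in> Field \<mu>" "t \<in> tuples \<mu> \<alpha> (psub \<mu> X)" by auto
  have "|Sigma (underS \<mu> \<alpha>) t| <o \<mu>"
    using a(3) by (intro stable_elim stable_mu card_of_underS Card_order_mu a(2)) (auto simp: tuples_def psub_def)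
  moreover have "Sigma (underS \<mu> \<alpha>) t \<subseteq> Field \<mu> \<times> X"
  proof -
    have "underS \<mu> \<alpha> \<subseteq> Field \<mu>" by (auto simp: underS_def Field_def)
    moreover have "t \<beta> \<subseteq> X" if "\<beta> \<in> underS \<mu> \<alpha>" for \<beta>
      using a(3) that by (auto simp: tuples_def psub_def PiE_def Pi_def)
    ultimately show ?thesis by blast
  qed
  ultimately show "?f a \<in> Field \<mu> \<times> psub \<mu> (Field \<mu> \<times> X)"
    using a by (auto simp: psub_def)
qed

lemma psub_upper: "|X| \<le>o |psub \<mu> X|"
  by (rule card_of_ordLeqI[where f = "\<lambda>x. {x}"]) (auto simp: psub_def finite_less)

text \<open>When \<open>X\<close> has at least \<mu> elements, both factors
  \<open>Field \<mu>\<close> in \<open>tuples_of_psub\<close> are absorbed. This is idempotence of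
  the power <\<mu>, expressed with subsets.\<close>

lemma tuples_of_psub_le:
  assumes "|Field \<mu>| \<le>o |X|"
  shows "|SIGMA \<alpha>:Field \<mu>. tuples \<mu> \<alpha> (psub \<mu> X)| \<le>o |psub \<mu> X|"
proof -
  have X: "\<not> finite X" using card_of_ordLeq_infinite[OF assms infinite_Field_mu] .
  have "|Field \<mu> \<times> X| \<le>o |X|"
    using card_of_Times_infinite[OF X _ assms] infinite_Field_mu ordIso_imp_ordLeq finite.emptyI by metis
  then have 1: "|psub \<mu> (Field \<mu> \<times> X)| \<le>o |psub \<mu> X|" by (rule psub_mono)
  have 2: "|Field \<mu>| \<le>o |psub \<mu> X|" by (rule ordLeq_transitive[OF assms psub_upper])
  have "\<not> finite (psub \<mu> X)" using card_of_ordLeq_infinite[OF psub_upper X] .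
  then have "|Field \<mu> \<times> psub \<mu> (Field \<mu> \<times> X)| \<le>o |psub \<mu> X|"
    using 1 2 by (intro card_of_Times_ordLeq_infinite_Field card_of_Card_order) (simp_all add: Field_card_of)
  then show ?thesis by (rule ordLeq_transitive[OF tuples_of_psub])
qed

text \<open>A sequence in \<open>X\<close> is in effect a sequence of singletons, so the bound for
  sequences of small sets covers it. Above \<mu>, counting subsets instead of sequences therefore
  changes nothing.\<close>

lemma pow_less_psub:
  assumes "|Field \<mu>| \<le>o |X|"
  shows "pow_less (card_of X) \<mu> =o |psub \<mu> X|"
proof -
  have "pow_less (card_of X) \<mu> \<le>o pow_less (card_of (psub \<mu> X)) \<mu>"
    by (rule pow_less_mono[OF psub_upper])
  also have "pow_less (card_of (psub \<mu> X)) \<mu> \<le>o |psub \<mu> X|"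
    using tuples_of_psub_le[OF assms] by (simp add: pow_less_def Field_card_of)
  finally have "pow_less (card_of X) \<mu> \<le>o |psub \<mu> X|" .
  then show ?thesis by (intro iffD2[OF ordIso_iff_ordLeq] conjI psub_le_pow_less)
qed

lemma pow_less_upper: "Card_order r \<Longrightarrow> r \<le>o pow_less r \<mu>"
proof -
  assume "Card_order r"
  then have "r =o |Field r|" using card_of_Field_ordIso ordIso_symmetric by blast
  moreover have "|Field r| \<le>o pow_less (card_of (Field r)) \<mu>"
    by (rule ordLeq_transitive[OF psub_upper psub_le_pow_less])
  ultimately show ?thesis by (simp add: pow_less_def Field_card_of ordIso_ordLeq_trans)
qed

text \<open>This is why \<lambda>, being a power <\<mu>, equals its own power <\<mu>. The detour
  through \<open>psub\<close> replaces sequences of sequences by sequences of sets, which regularity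
  allows to be coded by single sets.\<close>

lemma pow_less_idem:
  assumes "Card_order r" "\<mu> \<le>o r"
  shows "pow_less (pow_less r \<mu>) \<mu> =o pow_less r \<mu>"
proof -
  let ?X = "Field r"
  have X: "|Field \<mu>| \<le>o |?X|" by (rule card_of_mono2[OF assms(2)])
  have r: "pow_less r \<mu> =o |psub \<mu> ?X|"
    by (rule ordIso_transitive[OF pow_less_cong pow_less_psub[OF X]])
      (rule ordIso_symmetric[OF card_of_Field_ordIso[OF assms(1)]])
  have "pow_less (pow_less r \<mu>) \<mu> =o pow_less (card_of (psub \<mu> ?X)) \<mu>" by (rule pow_less_cong[OF r])
  also have "pow_less (card_of (psub \<mu> ?X)) \<mu> \<le>o |psub \<mu> ?X|"
    using tuples_of_psub_le[OF X] by (simp add: pow_less_def Field_card_of)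
  also have "|psub \<mu> ?X| =o pow_less r \<mu>" using r by (rule ordIso_symmetric)
  finally have "pow_less (pow_less r \<mu>) \<mu> \<le>o pow_less r \<mu>" .
  then show ?thesis
    by (intro iffD2[OF ordIso_iff_ordLeq] conjI pow_less_upper Card_order_pow_less)
qed

lemma pow_less_closed_cong:
  assumes "b =o c" "pow_less c \<mu> =o c" shows "pow_less b \<mu> \<le>o b"
  by (rule ordIso_imp_ordLeq, rule ordIso_transitive[OF pow_less_cong[OF assms(1)]],
      rule ordIso_transitive[OF assms(2)], rule ordIso_symmetric[OF assms(1)])

text \<open>The sum collapses to its larger term: to \<open>l\<close> if \<open>a\<close> is at most
  \<open>l\<close>, and otherwise to the power of \<open>a\<close>, where idempotence applies since
  \<open>a\<close> is then above \<mu>. Hence the bound in the Loewenheim-Skolem-Tarski axiom can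
  itself serve as the size of a directed closure.\<close>

lemma pow_less_csum_closed:
  assumes a: "Card_order a" and l: "Card_order l" and ml: "\<mu> \<le>o l" and pl: "pow_less l \<mu> =o l"
  shows "pow_less (pow_less a \<mu> +c l) \<mu> \<le>o pow_less a \<mu> +c l"
proof -
  let ?b = "pow_less a \<mu> +c l"
  have li: "Cinfinite l" using cinfinite_mono[OF ml] Cinfinite_mu l by blast
  show ?thesis
  proof (cases "a \<le>o l")
    case True
    then have "pow_less a \<mu> \<le>o l" by (rule ordLeq_ordIso_trans[OF pow_less_mono pl])
    then have "?b =o l" by (rule csum_absorb2[OF li])
    then show ?thesis using pl by (rule pow_less_closed_cong)
  next
    case False
    then have la: "l \<le>o a"
      using ordLeq_total[of a l] card_order_on_well_order_on[OF a] card_order_on_well_order_on[OF l] by auto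
    then have ma: "\<mu> \<le>o a" by (rule ordLeq_transitive[OF ml])
    have ap: "a \<le>o pow_less a \<mu>" by (rule pow_less_upper[OF a])
    have "Cinfinite (pow_less a \<mu>)"
      using cinfinite_mono[OF ordLeq_transitive[OF ma ap]] Cinfinite_mu Card_order_pow_less by blast
    moreover have "l \<le>o pow_less a \<mu>" by (rule ordLeq_transitive[OF la ap])
    ultimately have "?b =o pow_less a \<mu>" by (rule csum_absorb1)
    then show ?thesis using pow_less_idem[OF a ma] by (rule pow_less_closed_cong)
  qed
qed

end

section \<open>Directed subsets of bounded size\<close>

text \<open>A transfinite recursion phrased as an inductive predicate: the size of stage \<open>\<alpha>\<close> is then
  bounded by induction on \<open>\<alpha>\<close>.\<close>

inductive stage :: "'k rel \<Rightarrow> ('a set \<Rightarrow> 'a) \<Rightarrow> 'a set \<Rightarrow> 'k \<Rightarrow> 'a \<Rightarrow> bool"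
  for \<mu> ub A where
  base: "x \<in> A \<Longrightarrow> stage \<mu> ub A \<alpha> x"
| step: "\<gamma> \<in> underS \<mu> \<alpha> \<Longrightarrow> \<forall>y\<in>Y. stage \<mu> ub A \<gamma> y \<Longrightarrow> |Y| <o \<mu> \<Longrightarrow> stage \<mu> ub A \<alpha> (ub Y)"

context regular_card
begin

text \<open>Stage \<open>\<alpha>\<close> is covered by \<open>A\<close> and by one bound for each
  small subset of each earlier stage. There are fewer than \<mu> earlier stages, and closure of
  \<open>b\<close> under powers <\<mu> limits the subsets of each to \<open>b\<close>.\<close>

lemma stage_card:
  assumes b: "Card_order b" and mb: "\<mu> \<le>o b" and pb: "pow_less b \<mu> \<le>o b" and A: "|A| \<le>o b"
    and \<alpha>: "\<alpha> \<in> Field \<mu>"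
  shows "|{x. stage \<mu> ub A \<alpha> x}| \<le>o b"
proof -
  have wo: "wo_rel \<mu>" using Card_order_mu card_order_on_well_order_on by (auto simp: wo_rel_def)
  have bi: "Cinfinite b" using cinfinite_mono[OF mb] Cinfinite_mu b by blast
  show ?thesis
    using \<alpha>
  proof (induction \<alpha> rule: wo_rel.well_order_induct[OF wo])
    case (1 \<alpha>)
    let ?S = "\<lambda>\<alpha>. {x. stage \<mu> ub A \<alpha> x}"
    have "?S \<alpha> \<subseteq> A \<union> (\<Union>\<gamma>\<in>underS \<mu> \<alpha>. ub ` psub \<mu> (?S \<gamma>))"
      by (auto elim!: stage.cases simp: psub_def)
    moreover have "|A \<union> (\<Union>\<gamma>\<in>underS \<mu> \<alpha>. ub ` psub \<mu> (?S \<gamma>))| \<le>o b"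
    proof (intro Un_Cinfinite_bound A UNION_Cinfinite_bound ballI bi)
      show "|underS \<mu> \<alpha>| \<le>o b"
        by (rule ordLeq_transitive[OF ordLess_imp_ordLeq[OF card_of_underS[OF Card_order_mu \<open>\<alpha> \<in> Field \<mu>\<close>]] mb])
      fix \<gamma> assume g: "\<gamma> \<in> underS \<mu> \<alpha>"
      then have "|?S \<gamma>| \<le>o b" using 1 by (auto simp: underS_def Field_def)
      then have "pow_less (card_of (?S \<gamma>)) \<mu> \<le>o b"
        by (intro ordLeq_transitive[OF pow_less_mono pb])
      then show "|ub ` psub \<mu> (?S \<gamma>)| \<le>o b"
        by (intro ordLeq_transitive[OF card_of_image ordLeq_transitive[OF psub_le_pow_less]])
    qed
    ultimately show ?case by (rule ordLeq_transitive[OF card_of_mono1])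
  qed
qed

lemma stage_mono: "(\<alpha>, \<beta>) \<in> \<mu> \<Longrightarrow> stage \<mu> ub A \<alpha> x \<Longrightarrow> stage \<mu> ub A \<beta> x"
proof -
  assume ab: "(\<alpha>, \<beta>) \<in> \<mu>" and s: "stage \<mu> ub A \<alpha> x"
  have W: "Well_order \<mu>" using Card_order_mu card_order_on_well_order_on by blast
  from s show ?thesis
  proof cases
    case (step \<gamma> Y)
    have "\<gamma> \<in> underS \<mu> \<beta>"
      using step(2) ab W underS_incr[of \<mu> \<alpha> \<beta>]
      by (auto simp: well_order_on_def linear_order_on_def partial_order_on_def preorder_on_def)
    then show ?thesis using step stage.step by metis
  qed (simp add: stage.base)
qed

text \<open>The union of all stages below \<mu> is directed: by regularity fewer than \<mu> of its
  elements lie in a single stage, and since \<mu> has no last element there is a later stage that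
  contains their bound.\<close>

lemma directed_closure:
  assumes dir: "directed_poset \<mu> I r" and b: "Card_order b" and mb: "\<mu> \<le>o b"
    and pb: "pow_less b \<mu> \<le>o b" and A: "A \<subseteq> I" "|A| \<le>o b"
  obtains J where "A \<subseteq> J" "J \<subseteq> I" "|J| \<le>o b" "directed_poset \<mu> J (Restr r J)"
proof -
  have "\<forall>X. \<exists>c. X \<subseteq> I \<and> |X| <o \<mu> \<longrightarrow> c \<in> I \<and> (\<forall>x\<in>X. (x, c) \<in> r)"
    using dir by (auto simp: directed_poset_def)
  then obtain ub where ub: "\<And>X. X \<subseteq> I \<Longrightarrow> |X| <o \<mu> \<Longrightarrow> ub X \<in> I \<and> (\<forall>x\<in>X. (x, ub X) \<in> r)"
    by metis
  let ?S = "\<lambda>\<alpha>. {x. stage \<mu> ub A \<alpha> x}"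
  define J where "J = (\<Union>\<alpha>\<in>Field \<mu>. ?S \<alpha>)"
  have bi: "Cinfinite b" using cinfinite_mono[OF mb] Cinfinite_mu b by blast
  have SI: "x \<in> I" if "stage \<mu> ub A \<alpha> x" for \<alpha> x
    using that
  proof induction
    case (step \<gamma> \<alpha> Y) then show ?case using ub[of Y] by blast
  qed (use A in blast)
  have 1: "A \<subseteq> J" 
  proof -
    obtain \<alpha> where "\<alpha> \<in> Field \<mu>" using infinite_Field_mu by (metis finite.emptyI ex_in_conv)
    then show ?thesis by (auto simp: J_def intro: stage.base)
  qed
  have 2: "J \<subseteq> I" using SI by (auto simp: J_def)
  have "|Field \<mu>| \<le>o b"
    by (rule ordIso_ordLeq_trans[OF card_of_Field_ordIso[OF Card_order_mu] mb])
  then have 3: "|J| \<le>o b" unfolding J_def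
    by (intro UNION_Cinfinite_bound ballI stage_card assms bi)
  have "\<exists>c\<in>J. \<forall>x\<in>Y. (x, c) \<in> Restr r J" if Y: "Y \<subseteq> J" "|Y| <o \<mu>" for Y
  proof -
    have "relChain \<mu> ?S" using stage_mono by (auto simp: relChain_def)
    then obtain \<alpha> where a: "\<alpha> \<in> Field \<mu>" "Y \<subseteq> ?S \<alpha>"
      using regularCard_UNION[OF Card_order_mu regularCard_mu _ _ Y(2)] Y(1) unfolding J_def by blast
    obtain \<beta> where be: "\<beta> \<in> Field \<mu>" "\<alpha> \<in> underS \<mu> \<beta>" using less_above[OF a(1)] .
    have "stage \<mu> ub A \<beta> (ub Y)" using stage.step[OF be(2) _ Y(2)] a(2) by blast
    then have "ub Y \<in> J" using be(1) by (auto simp: J_def)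
    then show ?thesis using ub[of Y] Y 2 by blast
  qed
  moreover have "partial_order_on J (Restr r J)"
    using dir 2 unfolding directed_poset_def partial_order_on_def preorder_on_def
    by (auto simp: refl_on_def antisym_def trans_def)
  ultimately have "directed_poset \<mu> J (Restr r J)"
    by (auto simp: directed_poset_def)
  then show thesis using that 1 2 3 by blast
qed

end

section \<open>Directed colimits in a category of monomorphisms\<close>

locale category_locale =
  fixes C :: "('o, 'm) cat"
  assumes cat: "category C"
begin

abbreviation comp (infixl "\<cdot>" 70) where "g \<cdot> f \<equiv> Comp C g f"

lemma category_axioms:
  "\<And>f. f \<in> Arr C \<Longrightarrow> Dom C f \<in> Obj C \<and> Cod C f \<in> Obj C"
  "\<And>x. x \<in> Obj C \<Longrightarrow> Id C x \<in> Hom C x x"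
  "\<And>f g. f \<in> Arr C \<Longrightarrow> g \<in> Arr C \<Longrightarrow> Dom C g = Cod C f \<Longrightarrow> g \<cdot> f \<in> Hom C (Dom C f) (Cod C g)"
  "\<And>f. f \<in> Arr C \<Longrightarrow> f \<cdot> Id C (Dom C f) = f \<and> Id C (Cod C f) \<cdot> f = f"
  "\<And>f g h. f \<in> Arr C \<Longrightarrow> g \<in> Arr C \<Longrightarrow> h \<in> Arr C \<Longrightarrow> Dom C g = Cod C f \<Longrightarrow>
     Dom C h = Cod C g \<Longrightarrow> h \<cdot> (g \<cdot> f) = h \<cdot> g \<cdot> f"
  using cat unfolding category_def by blast+

lemma HomD: "f \<in> Hom C x y \<Longrightarrow> f \<in> Arr C \<and> Dom C f = x \<and> Cod C f = y"
  by (simp add: Hom_def)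

lemma hom_objs: "f \<in> Hom C x y \<Longrightarrow> x \<in> Obj C" "f \<in> Hom C x y \<Longrightarrow> y \<in> Obj C"
  using category_axioms(1) HomD by blast+

lemmas id_hom = category_axioms(2)

lemma comp_hom: "f \<in> Hom C x y \<Longrightarrow> g \<in> Hom C y z \<Longrightarrow> g \<cdot> f \<in> Hom C x z"
  using category_axioms(3)[of f g] HomD[of f x y] HomD[of g y z] by simp

lemma id_left: "f \<in> Hom C x y \<Longrightarrow> Id C y \<cdot> f = f"
  using category_axioms(4)[of f] HomD[of f x y] by simp

lemma id_right: "f \<in> Hom C x y \<Longrightarrow> f \<cdot> Id C x = f"
  using category_axioms(4)[of f] HomD[of f x y] by simp

lemma assoc:
  "f \<in> Hom C w x \<Longrightarrow> g \<in> Hom C x y \<Longrightarrow> h \<in> Hom C y z \<Longrightarrow> h \<cdot> g \<cdot> f = h \<cdot> (g \<cdot> f)"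
  using category_axioms(5)[of f g h] HomD[of f w x] HomD[of g x y] HomD[of h y z] by simp

lemma isomorphic_refl: "x \<in> Obj C \<Longrightarrow> isomorphic_objects C x x"
  unfolding isomorphic_objects_def using id_hom[of x] id_left[of "Id C x" x x] by blast

lemma isomorphic_sym: "isomorphic_objects C x y \<Longrightarrow> isomorphic_objects C y x"
  unfolding isomorphic_objects_def by blast

lemma isomorphic_trans:
  assumes "isomorphic_objects C x y" "isomorphic_objects C y z"
  shows "isomorphic_objects C x z"
proof -
  obtain f f' g g' where f: "f \<in> Hom C x y" "f' \<in> Hom C y x" "f' \<cdot> f = Id C x" "f \<cdot> f' = Id C y"
    and g: "g \<in> Hom C y z" "g' \<in> Hom C z y" "g' \<cdot> g = Id C y" "g \<cdot> g' = Id C z"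
    using assms unfolding isomorphic_objects_def by blast
  have gf: "g \<cdot> f \<in> Hom C x z" and fg: "f' \<cdot> g' \<in> Hom C z x"
    using f g comp_hom by blast+
  have "(f' \<cdot> g') \<cdot> (g \<cdot> f) = f' \<cdot> ((g' \<cdot> g) \<cdot> f)"
    by (simp only: assoc[OF gf g(2) f(2)] assoc[OF f(1) g(1) g(2)])
  then have 1: "(f' \<cdot> g') \<cdot> (g \<cdot> f) = Id C x"
    by (simp only: g(3) id_left[OF f(1)] f(3))
  have "(g \<cdot> f) \<cdot> (f' \<cdot> g') = g \<cdot> ((f \<cdot> f') \<cdot> g')"
    by (simp only: assoc[OF fg f(1) g(1)] assoc[OF g(2) f(2) f(1)])
  then have 2: "(g \<cdot> f) \<cdot> (f' \<cdot> g') = Id C z"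
    by (simp only: f(4) id_left[OF g(2)] g(4))
  show ?thesis unfolding isomorphic_objects_def using gf fg 1 2 by blast
qed

lemma diagramD:
  assumes "diagram C I r D\<^sub>0 D\<^sub>1"
  shows "i \<in> I \<Longrightarrow> D\<^sub>0 i \<in> Obj C" "i \<in> I \<Longrightarrow> D\<^sub>1 i i = Id C (D\<^sub>0 i)"
    "(i, j) \<in> r \<Longrightarrow> D\<^sub>1 i j \<in> Hom C (D\<^sub>0 i) (D\<^sub>0 j)"
    "(i, j) \<in> r \<Longrightarrow> (j, k) \<in> r \<Longrightarrow> D\<^sub>1 i k = D\<^sub>1 j k \<cdot> D\<^sub>1 i j"
  using assms by (auto simp: diagram_def)

lemma colimitD:
  assumes "colimit C I r D\<^sub>0 D\<^sub>1 c \<phi>"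
  shows "c \<in> Obj C" "i \<in> I \<Longrightarrow> \<phi> i \<in> Hom C (D\<^sub>0 i) c"
    "(i, j) \<in> r \<Longrightarrow> \<phi> j \<cdot> D\<^sub>1 i j = \<phi> i"
  using assms by (auto simp: colimit_def cocone_def)

text \<open>Uniqueness in the universal property, applied to the cocone induced by
  \<open>v\<close>.\<close>

lemma colimit_eq:
  assumes c: "colimit C I r D\<^sub>0 D\<^sub>1 c \<phi>" and d: "diagram C I r D\<^sub>0 D\<^sub>1" and r: "r \<subseteq> I \<times> I"
    and u: "u \<in> Hom C c x" and v: "v \<in> Hom C c x" and eq: "\<And>i. i \<in> I \<Longrightarrow> u \<cdot> \<phi> i = v \<cdot> \<phi> i"
  shows "u = v"
proof -
  have "cocone C I r D\<^sub>0 D\<^sub>1 x (\<lambda>i. v \<cdot> \<phi> i)"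
    unfolding cocone_def
  proof (intro conjI ballI allI impI)
    show "x \<in> Obj C" using u hom_objs by blast
    show "v \<cdot> \<phi> i \<in> Hom C (D\<^sub>0 i) x" if "i \<in> I" for i using comp_hom[OF colimitD(2)[OF c that] v] .
    fix i j assume ij: "(i, j) \<in> r"
    then have "j \<in> I" using r by blast
    from assoc[OF diagramD(3)[OF d ij] colimitD(2)[OF c this] v]
    show "v \<cdot> \<phi> j \<cdot> D\<^sub>1 i j = v \<cdot> \<phi> i" using colimitD(3)[OF c ij] by simp
  qed
  then have "\<exists>!w. w \<in> Hom C c x \<and> (\<forall>i\<in>I. w \<cdot> \<phi> i = v \<cdot> \<phi> i)"
    using c by (simp add: colimit_def)
  then show ?thesis using u v eq by blast
qed

text \<open>Conjugating the connecting arrows by isomorphisms chosen independently at each index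
  stays functorial, because the inner pair \<open>s j\<close>, \<open>t j\<close> cancels. It serves
  to move a diagram of presentable objects into the skeleton.\<close>

lemma colimit_iso_diagram:
  assumes c: "colimit C I r D\<^sub>0 D\<^sub>1 c \<phi>" and d: "diagram C I r D\<^sub>0 D\<^sub>1" and r: "r \<subseteq> I \<times> I"
    and s: "\<And>i. i \<in> I \<Longrightarrow> s i \<in> Hom C (E i) (D\<^sub>0 i)" and t: "\<And>i. i \<in> I \<Longrightarrow> t i \<in> Hom C (D\<^sub>0 i) (E i)"
    and st: "\<And>i. i \<in> I \<Longrightarrow> s i \<cdot> t i = Id C (D\<^sub>0 i)" and ts: "\<And>i. i \<in> I \<Longrightarrow> t i \<cdot> s i = Id C (E i)"
  shows "diagram C I r E (\<lambda>i j. t j \<cdot> (D\<^sub>1 i j \<cdot> s i))"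
    and "colimit C I r E (\<lambda>i j. t j \<cdot> (D\<^sub>1 i j \<cdot> s i)) c (\<lambda>i. \<phi> i \<cdot> s i)"
proof -
  let ?E = "\<lambda>i j. t j \<cdot> (D\<^sub>1 i j \<cdot> s i)"
  note D = diagramD[OF d] and c' = colimitD[OF c]
  have rI: "i \<in> I" "j \<in> I" if "(i, j) \<in> r" for i j using that r by auto
  have st': "s i \<cdot> (t i \<cdot> f) = f" if "i \<in> I" "f \<in> Hom C x (D\<^sub>0 i)" for i f x
    using assoc[OF that(2) t s] st id_left that by simp
  have ts': "t i \<cdot> (s i \<cdot> f) = f" if "i \<in> I" "f \<in> Hom C x (E i)" for i f x
    using assoc[OF that(2) s t] ts id_left that by simp
  have Ds: "D\<^sub>1 i j \<cdot> s i \<in> Hom C (E i) (D\<^sub>0 j)" if "(i, j) \<in> r" for i j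
    using comp_hom s D(3) rI that by blast
  show "diagram C I r E ?E"
    unfolding diagram_def
  proof (intro conjI ballI allI impI)
    fix i assume i: "i \<in> I"
    show "E i \<in> Obj C" using s[OF i] hom_objs by blast
    show "t i \<cdot> (D\<^sub>1 i i \<cdot> s i) = Id C (E i)"
      using id_left[OF s[OF i]] ts[OF i] D(2)[OF i] by simp
  next
    fix i j assume ij: "(i, j) \<in> r"
    show "?E i j \<in> Hom C (E i) (E j)" using comp_hom Ds t rI ij by blast
    fix k assume jk: "(j, k) \<in> r"
    have Dsj: "D\<^sub>1 j k \<cdot> s j \<in> Hom C (E j) (D\<^sub>0 k)" by (rule Ds[OF jk])
    have tD: "t j \<cdot> (D\<^sub>1 i j \<cdot> s i) \<in> Hom C (E i) (E j)" using comp_hom Ds t rI ij by blast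
    have "?E j k \<cdot> ?E i j = t k \<cdot> (D\<^sub>1 j k \<cdot> s j \<cdot> ?E i j)"
      by (rule assoc[OF tD Dsj t]) (use rI jk in blast)
    also have "D\<^sub>1 j k \<cdot> s j \<cdot> ?E i j = D\<^sub>1 j k \<cdot> (s j \<cdot> ?E i j)"
      by (rule assoc[OF tD s D(3)[OF jk]]) (use rI jk in blast)
    also have "s j \<cdot> ?E i j = D\<^sub>1 i j \<cdot> s i" using st' Ds rI ij by blast
    also have "D\<^sub>1 j k \<cdot> (D\<^sub>1 i j \<cdot> s i) = D\<^sub>1 j k \<cdot> D\<^sub>1 i j \<cdot> s i"
      by (rule assoc[OF s D(3)[OF ij] D(3)[OF jk], symmetric]) (use rI ij in blast)
    also have "D\<^sub>1 j k \<cdot> D\<^sub>1 i j = D\<^sub>1 i k" by (rule D(4)[OF ij jk, symmetric])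
    finally show "?E i k = ?E j k \<cdot> ?E i j" ..
  qed
  show "colimit C I r E ?E c (\<lambda>i. \<phi> i \<cdot> s i)"
    unfolding colimit_def
  proof (intro conjI allI impI)
    show "cocone C I r E ?E c (\<lambda>i. \<phi> i \<cdot> s i)"
      unfolding cocone_def
    proof (intro conjI ballI allI impI)
      show "c \<in> Obj C" by (rule c'(1))
      show "\<phi> i \<cdot> s i \<in> Hom C (E i) c" if "i \<in> I" for i
        using comp_hom[OF s c'(2)] that by blast
      fix i j assume ij: "(i, j) \<in> r"
      note I = rI[OF ij]
      have tD: "t j \<cdot> (D\<^sub>1 i j \<cdot> s i) \<in> Hom C (E i) (E j)" using comp_hom Ds t I ij by blast
      have "\<phi> j \<cdot> s j \<cdot> ?E i j = \<phi> j \<cdot> (s j \<cdot> ?E i j)"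
        by (rule assoc[OF tD s[OF I(2)] c'(2)[OF I(2)]])
      also have "s j \<cdot> ?E i j = D\<^sub>1 i j \<cdot> s i" using st' Ds I ij by blast
      also have "\<phi> j \<cdot> (D\<^sub>1 i j \<cdot> s i) = \<phi> j \<cdot> D\<^sub>1 i j \<cdot> s i"
        by (rule assoc[OF s[OF I(1)] D(3)[OF ij] c'(2)[OF I(2)], symmetric])
      finally show "\<phi> j \<cdot> s j \<cdot> ?E i j = \<phi> i \<cdot> s i" using c'(3)[OF ij] by simp
    qed
    fix x \<psi> assume co: "cocone C I r E ?E x \<psi>"
    then have \<psi>: "\<And>i. i \<in> I \<Longrightarrow> \<psi> i \<in> Hom C (E i) x" "\<And>i j. (i, j) \<in> r \<Longrightarrow> \<psi> j \<cdot> ?E i j = \<psi> i"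
      and x: "x \<in> Obj C"
      by (auto simp: cocone_def)
    have "cocone C I r D\<^sub>0 D\<^sub>1 x (\<lambda>i. \<psi> i \<cdot> t i)"
      unfolding cocone_def
    proof (intro conjI ballI allI impI x)
      show "\<psi> i \<cdot> t i \<in> Hom C (D\<^sub>0 i) x" if "i \<in> I" for i
        using comp_hom[OF t \<psi>(1)] that by blast
      fix i j assume ij: "(i, j) \<in> r"
      note I = rI[OF ij]
      have tD: "t j \<cdot> (D\<^sub>1 i j \<cdot> s i) \<in> Hom C (E i) (E j)" using comp_hom Ds t I ij by blast
      have "\<psi> i \<cdot> t i = \<psi> j \<cdot> ?E i j \<cdot> t i" using \<psi>(2)[OF ij] by simp
      also have "\<dots> = \<psi> j \<cdot> (?E i j \<cdot> t i)" by (rule assoc[OF t[OF I(1)] tD \<psi>(1)[OF I(2)]])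
      also have "?E i j \<cdot> t i = t j \<cdot> (D\<^sub>1 i j \<cdot> s i \<cdot> t i)" by (rule assoc[OF t[OF I(1)] Ds[OF ij] t[OF I(2)]])
      also have "D\<^sub>1 i j \<cdot> s i \<cdot> t i = D\<^sub>1 i j \<cdot> (s i \<cdot> t i)" by (rule assoc[OF t[OF I(1)] s[OF I(1)] D(3)[OF ij]])
      also have "\<dots> = D\<^sub>1 i j" using st[OF I(1)] id_right[OF D(3)[OF ij]] by simp
      also have "\<psi> j \<cdot> (t j \<cdot> D\<^sub>1 i j) = \<psi> j \<cdot> t j \<cdot> D\<^sub>1 i j"
        by (rule assoc[OF D(3)[OF ij] t[OF I(2)] \<psi>(1)[OF I(2)], symmetric])
      finally show "\<psi> j \<cdot> t j \<cdot> D\<^sub>1 i j = \<psi> i \<cdot> t i" ..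
    qed
    then obtain u where u: "u \<in> Hom C c x" "\<forall>i\<in>I. u \<cdot> \<phi> i = \<psi> i \<cdot> t i"
      using c unfolding colimit_def by blast
    show "\<exists>!u. u \<in> Hom C c x \<and> (\<forall>i\<in>I. u \<cdot> (\<phi> i \<cdot> s i) = \<psi> i)"
    proof (rule ex1I[of _ u], intro conjI ballI)
      show "u \<in> Hom C c x" by (rule u(1))
      fix i assume i: "i \<in> I"
      have "u \<cdot> (\<phi> i \<cdot> s i) = \<psi> i \<cdot> t i \<cdot> s i"
        using assoc[OF s[OF i] c'(2)[OF i] u(1)] u(2) i by simp
      also have "\<dots> = \<psi> i \<cdot> (t i \<cdot> s i)" by (rule assoc[OF s[OF i] t[OF i] \<psi>(1)[OF i]])
      also have "\<dots> = \<psi> i" using ts[OF i] id_right[OF \<psi>(1)[OF i]] by simp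
      finally show "u \<cdot> (\<phi> i \<cdot> s i) = \<psi> i" .
    next
      fix v assume v: "v \<in> Hom C c x \<and> (\<forall>i\<in>I. v \<cdot> (\<phi> i \<cdot> s i) = \<psi> i)"
      show "v = u"
      proof (rule colimit_eq[OF c d r])
        show "v \<in> Hom C c x" "u \<in> Hom C c x" using v u by auto
        fix i assume i: "i \<in> I"
        have vp: "v \<cdot> \<phi> i \<in> Hom C (D\<^sub>0 i) x" using comp_hom[OF c'(2)[OF i]] v by blast
        have "v \<cdot> \<phi> i = v \<cdot> \<phi> i \<cdot> (s i \<cdot> t i)" using id_right[OF vp] st[OF i] by simp
        also have "\<dots> = v \<cdot> \<phi> i \<cdot> s i \<cdot> t i" by (rule assoc[OF t[OF i] s[OF i] vp, symmetric])
        also have "v \<cdot> \<phi> i \<cdot> s i = \<psi> i"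
          using assoc[OF s[OF i] c'(2)[OF i], of v x] v i by simp
        finally show "v \<cdot> \<phi> i = u \<cdot> \<phi> i" using u(2) i by simp
      qed
    qed
  qed
qed

text \<open>The image of the hom-sets along the colimit cocone is itself the vertex of a cocone, so the
  induced map into it splits its inclusion.\<close>

lemma presentable_factor:
  fixes \<kappa> :: "'u rel" and I :: "'u set"
  assumes ls: "locally_small \<kappa> C" and M: "presentable \<kappa> \<mu> C M"
    and I: "small \<kappa> I" "directed_poset \<mu> I r" and d: "diagram C I r D\<^sub>0 D\<^sub>1"
    and c: "colimit C I r D\<^sub>0 D\<^sub>1 c \<phi>" and f: "f \<in> Hom C M c"
  shows "\<exists>i\<in>I. \<exists>g\<in>Hom C M (D\<^sub>0 i). f = \<phi> i \<cdot> g"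
proof -
  let ?S = "set_cat \<kappa> :: (('m + 'u) set, _) cat"
  let ?H = "hom_obj C M c :: ('m + 'u) set"
  note c' = colimitD[OF c]
  have rI: "i \<in> I" "j \<in> I" if "(i, j) \<in> r" for i j using that I(2) by (auto simp: directed_poset_def)
  have col: "colimit ?S I r (\<lambda>i. hom_obj C M (D\<^sub>0 i)) (\<lambda>i j. hom_arr C M (D\<^sub>1 i j)) ?H (\<lambda>i. hom_arr C M (\<phi> i))"
    using M I d c unfolding presentable_def preserves_directed_colimits_def by blast
  have coc: "cocone ?S I r (\<lambda>i. hom_obj C M (D\<^sub>0 i)) (\<lambda>i j. hom_arr C M (D\<^sub>1 i j)) ?H (\<lambda>i. hom_arr C M (\<phi> i))"
    using col by (simp add: colimit_def)
  define Y :: "('m + 'u) set" where "Y = (\<Union>i\<in>I. (\<lambda>g. Inl (\<phi> i \<cdot> g)) ` Hom C M (D\<^sub>0 i))"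
  have YH: "Y \<subseteq> ?H" using comp_hom c'(2) by (fastforce simp: Y_def hom_obj_def)
  have smallH: "small \<kappa> ?H" using coc by (simp add: cocone_def set_cat_def)
  have smallY: "small \<kappa> Y" by (rule ordLeq_ordLess_trans[OF card_of_mono1[OF YH] smallH])
  have arr: "hom_arr C M (\<phi> i) = (hom_obj C M (D\<^sub>0 i), \<lambda>z\<in>hom_obj C M (D\<^sub>0 i). Inl (\<phi> i \<cdot> projl z), ?H)"
    if "i \<in> I" for i using c'(2)[OF that] by (simp add: hom_arr_def Hom_def)
  have arr1: "hom_arr C M (D\<^sub>1 i j) = (hom_obj C M (D\<^sub>0 i), \<lambda>z\<in>hom_obj C M (D\<^sub>0 i). Inl (D\<^sub>1 i j \<cdot> projl z), hom_obj C M (D\<^sub>0 j))"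
    if "(i, j) \<in> r" for i j using diagramD(3)[OF d that] by (simp add: hom_arr_def Hom_def)
  define \<psi> :: "'u \<Rightarrow> ('m + 'u) set \<times> ('m + 'u \<Rightarrow> 'm + 'u) \<times> ('m + 'u) set"
    where "\<psi> i = (hom_obj C M (D\<^sub>0 i), \<lambda>z\<in>hom_obj C M (D\<^sub>0 i). Inl (\<phi> i \<cdot> projl z), Y)" for i
  have "cocone ?S I r (\<lambda>i. hom_obj C M (D\<^sub>0 i)) (\<lambda>i j. hom_arr C M (D\<^sub>1 i j)) Y \<psi>"
    unfolding cocone_def
  proof (intro conjI ballI allI impI)
    show "Y \<in> Obj ?S" using smallY by (simp add: set_cat_def)
    fix i assume i: "i \<in> I"
    have "hom_arr C M (\<phi> i) \<in> Arr ?S" using coc i by (auto simp: cocone_def Hom_def)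
    then have "small \<kappa> (hom_obj C M (D\<^sub>0 i) :: ('m + 'u) set)" by (simp add: arr[OF i] set_cat_def)
    moreover have "(\<lambda>z\<in>hom_obj C M (D\<^sub>0 i). Inl (\<phi> i \<cdot> projl z)) \<in> hom_obj C M (D\<^sub>0 i) \<rightarrow>\<^sub>E Y"
      using i by (auto simp: Y_def hom_obj_def)
    ultimately show "\<psi> i \<in> Hom ?S (hom_obj C M (D\<^sub>0 i)) Y"
      using smallY by (simp add: \<psi>_def Hom_def set_cat_def)
  next
    fix i j assume ij: "(i, j) \<in> r"
    have "Comp ?S (hom_arr C M (\<phi> j)) (hom_arr C M (D\<^sub>1 i j)) = hom_arr C M (\<phi> i)"
      using coc ij by (simp add: cocone_def)
    then show "Comp ?S (\<psi> j) (hom_arr C M (D\<^sub>1 i j)) = \<psi> i"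
      by (simp add: arr[OF rI(1)[OF ij]] arr[OF rI(2)[OF ij]] arr1[OF ij] set_cat_def \<psi>_def)
  qed
  then obtain u where u: "u \<in> Hom ?S ?H Y" "\<forall>i\<in>I. Comp ?S u (hom_arr C M (\<phi> i)) = \<psi> i"
    using col unfolding colimit_def by blast
  obtain h where h: "u = (?H, h, Y)" "h \<in> ?H \<rightarrow>\<^sub>E Y"
    using u(1) by (auto simp: Hom_def set_cat_def)
  \<comment> \<open>\<open>?v\<close> is the induced map into \<open>Y\<close> followed by the
    inclusion into \<open>?H\<close>. It and the identity both factor the colimit cocone through
    itself, so uniqueness makes them equal.\<close>
  let ?v = "(?H, h, ?H)" and ?e = "(?H, \<lambda>z\<in>?H. z, ?H)"
  have "\<exists>!w. w \<in> Hom ?S ?H ?H \<and> (\<forall>i\<in>I. Comp ?S w (hom_arr C M (\<phi> i)) = hom_arr C M (\<phi> i))"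
    using col coc unfolding colimit_def by blast
  moreover have "?v \<in> Hom ?S ?H ?H" using h(2) YH smallH by (auto simp: Hom_def set_cat_def)
  moreover have "Comp ?S ?v (hom_arr C M (\<phi> i)) = hom_arr C M (\<phi> i)" if "i \<in> I" for i
    using bspec[OF u(2) that] by (simp add: arr[OF that] h(1) set_cat_def \<psi>_def)
  moreover have "?e \<in> Hom ?S ?H ?H" using smallH by (auto simp: Hom_def set_cat_def)
  moreover have "Comp ?S ?e (hom_arr C M (\<phi> i)) = hom_arr C M (\<phi> i)" if "i \<in> I" for i
    using comp_hom[OF _ c'(2)[OF that], of _ M]
    by (auto simp: arr[OF that] set_cat_def compose_def hom_obj_def fun_eq_iff)
  ultimately have "?v = ?e" by blast
  then have "h (Inl f) = Inl f" using f by (auto simp: hom_obj_def)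
  then have "Inl f \<in> Y" using h(2) f by (metis PiE_mem hom_obj_def imageI)
  then show ?thesis by (auto simp: Y_def)
qed

end

locale mono_cat = category_locale +
  assumes all_mono: "\<forall>f\<in>Arr C. monomorphism C f"
begin

lemma cancel:
  assumes "f \<in> Hom C x y" "g \<in> Hom C w x" "h \<in> Hom C w x" "f \<cdot> g = f \<cdot> h"
  shows "g = h"
proof -
  have "monomorphism C f" using all_mono HomD[OF assms(1)] by blast
  then show ?thesis
    using HomD[OF assms(1)] HomD[OF assms(2)] HomD[OF assms(3)] assms(4)
    unfolding monomorphism_def by metis
qed

text \<open>Cancel \<open>f\<close> on the left in
  \<open>f \<cdot> (s \<cdot> f) = f \<cdot> Id C x\<close>. A factorisation of an identity through
  a colimit cocone will thereby yield an isomorphism.\<close>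

lemma split_epi:
  assumes f: "f \<in> Hom C x y" and s: "s \<in> Hom C y x" and fs: "f \<cdot> s = Id C y"
  shows "s \<cdot> f = Id C x"
proof (rule cancel[OF f comp_hom[OF f s] id_hom])
  show "x \<in> Obj C" using f hom_objs by blast
  show "f \<cdot> (s \<cdot> f) = f \<cdot> Id C x"
    using assoc[OF f s f] fs id_left[OF f] id_right[OF f] by simp
qed

end

section \<open>Arrows tested on a dense small set of objects\<close>

lemma (in regular_card) directedD:
  assumes "directed_poset \<mu> I r"
  shows "r \<subseteq> I \<times> I" "(i, j) \<in> r \<Longrightarrow> i \<in> I" "(i, j) \<in> r \<Longrightarrow> j \<in> I" "i \<in> I \<Longrightarrow> (i, i) \<in> r"
    "(i, j) \<in> r \<Longrightarrow> (j, k) \<in> r \<Longrightarrow> (i, k) \<in> r" "I \<noteq> {}"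
    "X \<subseteq> I \<Longrightarrow> |X| <o \<mu> \<Longrightarrow> \<exists>b\<in>I. \<forall>x\<in>X. (x, b) \<in> r"
proof -
  have r: "r \<subseteq> I \<times> I" "partial_order_on I r"
    "\<forall>X\<subseteq>I. |X| <o \<mu> \<longrightarrow> (\<exists>b\<in>I. \<forall>x\<in>X. (x, b) \<in> r)"
    using assms by (auto simp: directed_poset_def)
  then show "r \<subseteq> I \<times> I" "(i, j) \<in> r \<Longrightarrow> i \<in> I" "(i, j) \<in> r \<Longrightarrow> j \<in> I" "i \<in> I \<Longrightarrow> (i, i) \<in> r"
    "(i, j) \<in> r \<Longrightarrow> (j, k) \<in> r \<Longrightarrow> (i, k) \<in> r"
    "X \<subseteq> I \<Longrightarrow> |X| <o \<mu> \<Longrightarrow> \<exists>b\<in>I. \<forall>x\<in>X. (x, b) \<in> r"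
    by (auto simp: partial_order_on_def preorder_on_def refl_on_def trans_def)
  show "I \<noteq> {}" using r(3)[rule_format, of "{}"] finite_less[of "{}"] by auto
qed

lemma (in regular_card) directed_pair:
  assumes "directed_poset \<mu> I r" "i \<in> I" "j \<in> I"
  obtains k where "k \<in> I" "(i, k) \<in> r" "(j, k) \<in> r"
  using directedD(7)[OF assms(1), of "{i, j}"] finite_less[of "{i, j}"] assms(2,3) by auto

text \<open>\<open>S_factor\<close> is the existence half of presentability, as produced by
  \<open>presentable_factor\<close>. The uniqueness half, that two factorisations agree at a later
  stage, is regained from the monomorphisms.\<close>

locale dense_mono_cat = regular_card \<mu> + mono_cat C
  for \<kappa> :: "'u rel" and \<mu> :: "'k rel" and C :: "('o, 'm) cat" and S :: "'o set" +
  assumes universe: "universe_for \<kappa> \<mu>"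
    and hom_small: "locally_small \<kappa> C"
    and colimit_exists: "\<And>(I :: 'u set) r D\<^sub>0 D\<^sub>1. small \<kappa> I \<Longrightarrow> directed_poset \<mu> I r \<Longrightarrow>
      diagram C I r D\<^sub>0 D\<^sub>1 \<Longrightarrow> \<exists>c \<phi>. colimit C I r D\<^sub>0 D\<^sub>1 c \<phi>"
    and S_obj: "S \<subseteq> Obj C" and S_small: "small \<kappa> S"
    and S_factor: "\<And>a (I :: 'u set) r D\<^sub>0 D\<^sub>1 c \<phi> f. a \<in> S \<Longrightarrow> small \<kappa> I \<Longrightarrow> directed_poset \<mu> I r \<Longrightarrow>
      diagram C I r D\<^sub>0 D\<^sub>1 \<Longrightarrow> colimit C I r D\<^sub>0 D\<^sub>1 c \<phi> \<Longrightarrow> f \<in> Hom C a c \<Longrightarrow>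
      \<exists>i\<in>I. \<exists>g\<in>Hom C a (D\<^sub>0 i). f = \<phi> i \<cdot> g"
    and S_dense: "\<And>x. x \<in> Obj C \<Longrightarrow> \<exists>(I :: 'u set) r D\<^sub>0 D\<^sub>1 \<phi>. small \<kappa> I \<and> directed_poset \<mu> I r \<and>
      diagram C I r D\<^sub>0 D\<^sub>1 \<and> D\<^sub>0 ` I \<subseteq> S \<and> colimit C I r D\<^sub>0 D\<^sub>1 x \<phi>"
begin

lemma kappa: "Card_order \<kappa>" "Cinfinite \<kappa>" "regularCard \<kappa>" "Field \<kappa> = UNIV" "\<mu> <o \<kappa>"
  using universe by (auto simp: universe_for_def regular_cardinal_def Field_card_order)

lemma small_UN: "small \<kappa> I \<Longrightarrow> (\<And>i. i \<in> I \<Longrightarrow> small \<kappa> (X i)) \<Longrightarrow> small \<kappa> (\<Union>i\<in>I. X i)"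
  using card_of_UNION_ordLess_infinite_Field_regularCard[OF kappa(3,2)] by blast

lemma small_subset: "small \<kappa> Y \<Longrightarrow> X \<subseteq> Y \<Longrightarrow> small \<kappa> X"
  using ordLeq_ordLess_trans[OF card_of_mono1] by blast

lemma small_image: "small \<kappa> X \<Longrightarrow> small \<kappa> (f ` X)"
  by (rule ordLeq_ordLess_trans[OF card_of_image])

text \<open>\<open>\<kappa>\<close> well-orders all of \<open>'u\<close>, so \<open>'u\<close> has
  room for a copy of each small set. Relation symbols and elements of carriers get their names in
  this way.\<close>

lemma small_embedding:
  assumes "small \<kappa> X" obtains e :: "_ \<Rightarrow> 'u" where "inj_on e X"
proof -
  have "|X| \<le>o |Field \<kappa>|"
    by (rule ordLeq_ordIso_trans[OF ordLess_imp_ordLeq[OF assms] ordIso_symmetric[OF card_of_Field_ordIso[OF kappa(1)]]])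
  then show thesis using that unfolding card_of_ordLeq[symmetric] by auto
qed

text \<open>The elements of the presheaf Hom(-, \<open>x\<close>) restricted to the full subcategory
  on \<open>S\<close>, with all sorts thrown together; the domain of an arrow remembers its
  sort.\<close>

definition G :: "'o \<Rightarrow> 'm set" where
  "G x = {f \<in> Arr C. Dom C f \<in> S \<and> Cod C f = x}"

definition arrS :: "'m set" where
  "arrS = {f \<in> Arr C. Dom C f \<in> S \<and> Cod C f \<in> S}"

lemma G_iff: "f \<in> G x \<longleftrightarrow> (\<exists>a\<in>S. f \<in> Hom C a x)"
  by (auto simp: G_def Hom_def)

lemma G_hom: "f \<in> G x \<Longrightarrow> f \<in> Hom C (Dom C f) x"
  by (auto simp: G_def Hom_def)

lemma arrS_hom: "g \<in> arrS \<Longrightarrow> g \<in> Hom C (Dom C g) (Cod C g)"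
  by (auto simp: arrS_def Hom_def)

lemma G_comp: "x \<in> G X \<Longrightarrow> u \<in> Hom C X Y \<Longrightarrow> u \<cdot> x \<in> G Y"
  unfolding G_iff using comp_hom by blast

lemma G_arr: "x \<in> G X \<Longrightarrow> g \<in> arrS \<Longrightarrow> Cod C g = Dom C x \<Longrightarrow> x \<cdot> g \<in> G X"
proof -
  assume x: "x \<in> G X" and g: "g \<in> arrS" and gx: "Cod C g = Dom C x"
  have "x \<cdot> g \<in> Hom C (Dom C g) X" by (rule comp_hom[OF arrS_hom[OF g]]) (use G_hom[OF x] gx in simp)
  then show ?thesis using g by (auto simp: G_iff arrS_def)
qed

lemma Dom_comp: "f \<in> Hom C x y \<Longrightarrow> g \<in> Hom C y z \<Longrightarrow> Dom C (g \<cdot> f) = x"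
  using comp_hom HomD by blast

lemma G_assoc: "x \<in> G X \<Longrightarrow> g \<in> arrS \<Longrightarrow> Cod C g = Dom C x \<Longrightarrow> u \<in> Hom C X Y \<Longrightarrow>
    u \<cdot> x \<cdot> g = u \<cdot> (x \<cdot> g)"
  by (metis assoc G_hom arrS_hom)

lemma id_arrS: "a \<in> S \<Longrightarrow> Id C a \<in> arrS"
  using id_hom[of a] S_obj HomD[of "Id C a" a a] by (auto simp: arrS_def)

lemma small_hom: "x \<in> Obj C \<Longrightarrow> y \<in> Obj C \<Longrightarrow> small \<kappa> (Hom C x y)"
  using hom_small by (simp add: locally_small_def)

lemma small_G: "x \<in> Obj C \<Longrightarrow> small \<kappa> (G x)"
proof -
  assume x: "x \<in> Obj C"
  have "G x = (\<Union>a\<in>S. Hom C a x)" by (auto simp: G_iff)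
  moreover have "small \<kappa> (\<Union>a\<in>S. Hom C a x)"
    by (intro small_UN S_small small_hom x) (use S_obj in blast)
  ultimately show ?thesis by simp
qed

lemma small_arrS: "small \<kappa> arrS"
proof -
  have "arrS = (\<Union>b\<in>S. G b)" by (auto simp: G_def arrS_def)
  moreover have "small \<kappa> (\<Union>b\<in>S. G b)"
    by (intro small_UN S_small small_G) (use S_obj in blast)
  ultimately show ?thesis by simp
qed

lemma G_factor:
  fixes I :: "'u set"
  assumes "small \<kappa> I" "directed_poset \<mu> I r" "diagram C I r D\<^sub>0 D\<^sub>1" "colimit C I r D\<^sub>0 D\<^sub>1 c \<phi>"
    and "x \<in> G c"
  obtains i g where "i \<in> I" "g \<in> G (D\<^sub>0 i)" "x = \<phi> i \<cdot> g" "Dom C g = Dom C x"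
proof -
  obtain a where a: "a \<in> S" "x \<in> Hom C a c" using assms(5) by (auto simp: G_iff)
  then obtain i g where ig: "i \<in> I" "g \<in> Hom C a (D\<^sub>0 i)" "x = \<phi> i \<cdot> g"
    using S_factor[OF a(1) assms(1-4) a(2)] by blast
  have "g \<in> G (D\<^sub>0 i)" using ig(2) a(1) by (auto simp: G_iff)
  then show thesis using that ig HomD[OF ig(2)] HomD[OF a(2)] by metis
qed

text \<open>Two representatives agree at a later stage because the colimit cocone consists of monomorphisms.\<close>

lemma colimit_representatives:
  assumes dir: "directed_poset \<mu> I r" and d: "diagram C I r D\<^sub>0 D\<^sub>1" and c: "colimit C I r D\<^sub>0 D\<^sub>1 c \<phi>"
    and ij: "i \<in> I" "j \<in> I" and x: "x \<in> Hom C a (D\<^sub>0 i)" and y: "y \<in> Hom C a (D\<^sub>0 j)"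
    and eq: "\<phi> i \<cdot> x = \<phi> j \<cdot> y"
  obtains k where "k \<in> I" "(i, k) \<in> r" "(j, k) \<in> r" "D\<^sub>1 i k \<cdot> x = D\<^sub>1 j k \<cdot> y"
proof -
  obtain k where k: "k \<in> I" "(i, k) \<in> r" "(j, k) \<in> r" using directed_pair[OF dir ij] .
  note Di = diagramD(3)[OF d k(2)] and Dj = diagramD(3)[OF d k(3)] and pk = colimitD(2)[OF c k(1)]
  have "\<phi> k \<cdot> (D\<^sub>1 i k \<cdot> x) = \<phi> k \<cdot> (D\<^sub>1 j k \<cdot> y)"
    using assoc[OF x Di pk] assoc[OF y Dj pk] colimitD(3)[OF c k(2)] colimitD(3)[OF c k(3)] eq by simp
  then have "D\<^sub>1 i k \<cdot> x = D\<^sub>1 j k \<cdot> y" using cancel[OF pk comp_hom[OF x Di] comp_hom[OF y Dj]] by blast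
  then show thesis using that k by blast
qed

text \<open>The cocone that presents \<open>X\<close> as a colimit of members of \<open>S\<close>
  consists of elements of \<open>G X\<close>, so agreement on \<open>G X\<close> includes agreement
  on that cocone.\<close>

lemma G_faithful:
  assumes u: "u \<in> Hom C X Y" and v: "v \<in> Hom C X Y" and eq: "\<And>x. x \<in> G X \<Longrightarrow> u \<cdot> x = v \<cdot> x"
  shows "u = v"
proof -
  obtain I :: "'u set" and r D\<^sub>0 D\<^sub>1 \<phi> where D: "small \<kappa> I" "directed_poset \<mu> I r" "diagram C I r D\<^sub>0 D\<^sub>1"
    "D\<^sub>0 ` I \<subseteq> S" "colimit C I r D\<^sub>0 D\<^sub>1 X \<phi>"
    using S_dense hom_objs(1)[OF u] by blast
  show ?thesis
  proof (rule colimit_eq[OF D(5,3) directedD(1)[OF D(2)] u v])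
    fix i assume "i \<in> I"
    then have "\<phi> i \<in> G X" using D(4) colimitD(2)[OF D(5)] by (auto simp: G_iff)
    then show "u \<cdot> \<phi> i = v \<cdot> \<phi> i" by (rule eq)
  qed
qed

text \<open>Naturality turns the images of the cocone arrows into a cocone on \<open>Y\<close>,
  which induces \<open>u\<close>. Any other element of \<open>G X\<close> is a cocone arrow after a
  member of \<open>arrS\<close>, and naturality extends the agreement to it.\<close>

lemma G_full:
  assumes X: "X \<in> Obj C" and Y: "Y \<in> Obj C"
    and t: "\<And>x. x \<in> G X \<Longrightarrow> t x \<in> G Y" "\<And>x. x \<in> G X \<Longrightarrow> Dom C (t x) = Dom C x"
    and nat: "\<And>x g. x \<in> G X \<Longrightarrow> g \<in> arrS \<Longrightarrow> Cod C g = Dom C x \<Longrightarrow> t (x \<cdot> g) = t x \<cdot> g"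
  obtains u where "u \<in> Hom C X Y" "\<And>x. x \<in> G X \<Longrightarrow> t x = u \<cdot> x"
proof -
  obtain I :: "'u set" and r D\<^sub>0 D\<^sub>1 \<phi> where D: "small \<kappa> I" "directed_poset \<mu> I r" "diagram C I r D\<^sub>0 D\<^sub>1"
    "D\<^sub>0 ` I \<subseteq> S" "colimit C I r D\<^sub>0 D\<^sub>1 X \<phi>"
    using S_dense X by blast
  note I = directedD[OF D(2)]
  have pG: "\<phi> i \<in> G X" "Dom C (\<phi> i) = D\<^sub>0 i" if "i \<in> I" for i
    using D(4) colimitD(2)[OF D(5) that] that by (auto simp: G_iff Hom_def)
  have DS: "D\<^sub>1 i j \<in> arrS" "Cod C (D\<^sub>1 i j) = D\<^sub>0 j" if "(i, j) \<in> r" for i j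
    using D(4) I(2,3)[OF that] diagramD(3)[OF D(3) that] by (auto simp: arrS_def Hom_def)
  have "cocone C I r D\<^sub>0 D\<^sub>1 Y (\<lambda>i. t (\<phi> i))"
    unfolding cocone_def
  proof (intro conjI ballI allI impI Y)
    show "t (\<phi> i) \<in> Hom C (D\<^sub>0 i) Y" if "i \<in> I" for i
      using G_hom[OF t(1)[OF pG(1)[OF that]]] t(2)[OF pG(1)[OF that]] pG(2)[OF that] by simp
    fix i j assume ij: "(i, j) \<in> r"
    then have j: "j \<in> I" using I by blast
    show "t (\<phi> j) \<cdot> D\<^sub>1 i j = t (\<phi> i)"
      using nat[OF pG(1)[OF j] DS(1)[OF ij]] DS(2)[OF ij] pG(2)[OF j] colimitD(3)[OF D(5) ij] by simp
  qed
  then obtain u where u: "u \<in> Hom C X Y" "\<forall>i\<in>I. u \<cdot> \<phi> i = t (\<phi> i)"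
    using D(5) unfolding colimit_def by blast
  have "t x = u \<cdot> x" if x: "x \<in> G X" for x
  proof -
    obtain i g where ig: "i \<in> I" "g \<in> G (D\<^sub>0 i)" "x = \<phi> i \<cdot> g" "Dom C g = Dom C x"
      using G_factor[OF D(1,2,3,5) x] .
    have g: "g \<in> arrS" "Cod C g = Dom C (\<phi> i)"
      using ig(1,2) D(4) pG(2) by (auto simp: G_def arrS_def)
    show ?thesis using nat[OF pG(1)[OF ig(1)] g] ig(3) u(2) ig(1) G_assoc[OF pG(1)[OF ig(1)] g u(1)] by simp
  qed
  then show thesis using that u(1) by blast
qed

text \<open>The cocone on \<open>X\<close> restricts to the smaller poset \<open>J\<close> and so
  induces \<open>u\<close> from the colimit over \<open>J\<close>. Its action hits all of
  \<open>B\<close> because each element of \<open>B\<close> factors through an index placed in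
  \<open>J\<close>.\<close>

lemma G_downward:
  assumes X: "X \<in> Obj C" and B: "B \<subseteq> G X" "|B| \<le>o b"
    and b: "Card_order b" "\<mu> \<le>o b" "pow_less b \<mu> \<le>o b" and S: "|arrS| \<le>o b"
  obtains Y u where "u \<in> Hom C Y X" "B \<subseteq> (\<lambda>y. u \<cdot> y) ` G Y" "|G Y| \<le>o b"
proof -
  obtain I :: "'u set" and r D\<^sub>0 D\<^sub>1 \<phi> where D: "small \<kappa> I" "directed_poset \<mu> I r" "diagram C I r D\<^sub>0 D\<^sub>1"
    "D\<^sub>0 ` I \<subseteq> S" "colimit C I r D\<^sub>0 D\<^sub>1 X \<phi>"
    using S_dense X by blast
  have "\<forall>x\<in>B. \<exists>i g. i \<in> I \<and> g \<in> G (D\<^sub>0 i) \<and> x = \<phi> i \<cdot> g"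
    using G_factor[OF D(1,2,3,5)] B(1) by (metis subsetD)
  then obtain n where n: "\<And>x. x \<in> B \<Longrightarrow> n x \<in> I \<and> (\<exists>g. g \<in> G (D\<^sub>0 (n x)) \<and> x = \<phi> (n x) \<cdot> g)"
    by metis
  obtain J where J: "n ` B \<subseteq> J" "J \<subseteq> I" "|J| \<le>o b" "directed_poset \<mu> J (Restr r J)"
    using directed_closure[OF D(2) b, of "n ` B"] n ordLeq_transitive[OF card_of_image B(2)] by blast
  have dJ: "diagram C J (Restr r J) D\<^sub>0 D\<^sub>1"
    using D(3) J(2) by (auto simp: diagram_def)
  have sJ: "small \<kappa> J" using small_subset[OF D(1) J(2)] .
  obtain Y \<psi> where Y: "colimit C J (Restr r J) D\<^sub>0 D\<^sub>1 Y \<psi>"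
    using colimit_exists[OF sJ J(4) dJ] by blast
  have "cocone C J (Restr r J) D\<^sub>0 D\<^sub>1 X \<phi>"
    using D(5) J(2) by (auto simp: colimit_def cocone_def)
  then obtain u where u: "u \<in> Hom C Y X" "\<forall>i\<in>J. u \<cdot> \<psi> i = \<phi> i"
    using Y unfolding colimit_def by blast
  have "B \<subseteq> (\<lambda>y. u \<cdot> y) ` G Y"
  proof
    fix x assume x: "x \<in> B"
    then obtain g where g: "g \<in> G (D\<^sub>0 (n x))" "x = \<phi> (n x) \<cdot> g" using n by blast
    have nx: "n x \<in> J" using x J(1) by blast
    have "x = u \<cdot> (\<psi> (n x) \<cdot> g)"
      using assoc[OF G_hom[OF g(1)] colimitD(2)[OF Y nx] u(1)] u(2) nx g(2) by simp
    then show "x \<in> (\<lambda>y. u \<cdot> y) ` G Y"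
      using G_comp[OF g(1) colimitD(2)[OF Y nx]] by blast
  qed
  moreover have "|G Y| \<le>o b"
  proof -
    \<comment> \<open>Arrows from \<open>S\<close> into \<open>Y\<close> factor through the stages
      of the diagram, which lie in \<open>S\<close> themselves. An index in \<open>J\<close> and an
      arrow between members of \<open>S\<close> thus determine an element of \<open>G Y\<close>,
      which is where the bound on \<open>arrS\<close> enters.\<close>
    have "G Y \<subseteq> (\<lambda>(i, g). \<psi> i \<cdot> g) ` (J \<times> arrS)"
    proof
      fix y assume "y \<in> G Y"
      then obtain i g where ig: "i \<in> J" "g \<in> G (D\<^sub>0 i)" "y = \<psi> i \<cdot> g" "Dom C g = Dom C y"
        using G_factor[OF sJ J(4) dJ Y] by metis
      then have "g \<in> arrS" using D(4) J(2) by (auto simp: G_def arrS_def)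
      then show "y \<in> (\<lambda>(i, g). \<psi> i \<cdot> g) ` (J \<times> arrS)" using ig by force
    qed
    moreover have "|J \<times> arrS| \<le>o b"
      using cinfinite_mono[OF b(2)] Cinfinite_mu J(3) S b(1)
      by (intro card_of_Times_ordLeq_infinite_Field) (auto simp: cinfinite_def)
    ultimately show ?thesis using ordLeq_transitive[OF surj_imp_ordLeq] by blast
  qed
  ultimately show thesis using that u(1) by blast
qed

end

section \<open>Coding objects as structures\<close>

text \<open>An object \<open>x\<close> is coded by the set \<open>G x\<close> of its arrows from \<open>S\<close>. Each arrow \<open>g\<close> between members
  of \<open>S\<close> gives a relation symbol, whose interpretation is the graph of precomposition with \<open>g\<close>. Pairs
  are coded as tuples of a fixed length \<open>\<alpha> \<ge> 2\<close>, with the second component at position \<open>q\<close> and the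
  first component at all other positions.\<close>

locale structure_coding = dense_mono_cat \<kappa> \<mu> C S
  for \<kappa> :: "'u rel" and \<mu> :: "'k rel" and C :: "('o, 'm) cat" and S :: "'o set" +
  fixes Sy :: "'u set" and dec :: "'u \<Rightarrow> 'm" and \<alpha> p q :: 'k
  assumes dec: "bij_betw dec Sy arrS"
    and \<alpha>: "\<alpha> \<in> Field \<mu>" and pq: "p \<in> underS \<mu> \<alpha>" "q \<in> underS \<mu> \<alpha>" "p \<noteq> q"
begin

text \<open>Precomposition with an arrow is partial, being defined only on arrows with the right
  domain; hence relation symbols and no function symbols. A symbol is a name in \<open>'u\<close>
  for an arrow, read back by \<open>dec\<close>.\<close>

definition L :: "('u, 'k) language" where
  "L = \<lparr>fun_syms = {}, rel_syms = Sy, fun_arity = \<lambda>_. \<alpha>, rel_arity = \<lambda>_. \<alpha>\<rparr>"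

lemma L_simps [simp]: "fun_syms L = {}" "rel_syms L = Sy" "rel_arity L R = \<alpha>"
  by (simp_all add: L_def)

abbreviation T :: "'a set \<Rightarrow> ('k \<Rightarrow> 'a) set" where "T X \<equiv> tuples \<mu> \<alpha> X"
abbreviation cmp :: "('a \<Rightarrow> 'b) \<Rightarrow> ('k \<Rightarrow> 'a) \<Rightarrow> 'k \<Rightarrow> 'b" where "cmp h t \<equiv> compose (underS \<mu> \<alpha>) h t"

definition pair_tuple :: "'a \<Rightarrow> 'a \<Rightarrow> 'k \<Rightarrow> 'a" where
  "pair_tuple x y = (\<lambda>i\<in>underS \<mu> \<alpha>. if i = q then y else x)"

lemma pair_tuple_T: "pair_tuple x y \<in> T X \<longleftrightarrow> x \<in> X \<and> y \<in> X"
proof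
  assume "pair_tuple x y \<in> T X"
  then have "pair_tuple x y p \<in> X" "pair_tuple x y q \<in> X" using pq by (auto simp: tuples_def)
  then show "x \<in> X \<and> y \<in> X" using pq by (simp add: pair_tuple_def)
qed (auto simp: tuples_def pair_tuple_def)

lemma pair_tuple_eq: "pair_tuple x y = pair_tuple x' y' \<longleftrightarrow> x = x' \<and> y = y'"
proof
  assume "pair_tuple x y = pair_tuple x' y'"
  from fun_cong[OF this, of p] fun_cong[OF this, of q] show "x = x' \<and> y = y'"
    using pq by (simp add: pair_tuple_def)
qed simp

lemma cmp_pair_tuple: "cmp h (pair_tuple x y) = pair_tuple (h x) (h y)"
  by (auto simp: compose_def pair_tuple_def fun_eq_iff)

lemma cmp_T: "t \<in> T X \<Longrightarrow> h ` X \<subseteq> Y \<Longrightarrow> cmp h t \<in> T Y"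
  by (auto simp: tuples_def compose_def)

lemma cmp_cong: "t \<in> T X \<Longrightarrow> (\<And>x. x \<in> X \<Longrightarrow> h x = k x) \<Longrightarrow> cmp h t = cmp k t"
  by (auto simp: tuples_def compose_def fun_eq_iff)

lemma cmp_cmp: "cmp h (cmp k t) = cmp (h \<circ> k) t"
  by (auto simp: compose_def fun_eq_iff)

lemma cmp_id: "t \<in> T X \<Longrightarrow> cmp (\<lambda>x. x) t = t"
  by (auto simp: tuples_def compose_def fun_eq_iff PiE_def extensional_def)

lemma cmp_inj: "inj_on h X \<Longrightarrow> s \<in> T X \<Longrightarrow> t \<in> T X \<Longrightarrow> cmp h s = cmp h t \<Longrightarrow> s = t"
proof -
  assume h: "inj_on h X" and s: "s \<in> T X" and t: "t \<in> T X" and eq: "cmp h s = cmp h t"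
  show ?thesis
  proof (rule PiE_ext[OF s[unfolded tuples_def] t[unfolded tuples_def]])
    fix i assume i: "i \<in> underS \<mu> \<alpha>"
    with fun_cong[OF eq, of i] have "h (s i) = h (t i)" by (simp add: compose_def)
    moreover have "s i \<in> X" "t i \<in> X" using s t i by (auto simp: tuples_def)
    ultimately show "s i = t i" using h by (auto dest: inj_onD)
  qed
qed

lemma cmp_surj:
  assumes "h ` X = Y" "t \<in> T Y" obtains s where "s \<in> T X" "cmp h s = t"
proof -
  let ?g = "inv_into X h"
  have "cmp ?g t \<in> T X" using assms by (intro cmp_T[OF assms(2)]) (auto intro: inv_into_into)
  moreover have "cmp h (cmp ?g t) = t"
    using cmp_cong[OF assms(2), of "h \<circ> ?g" "\<lambda>x. x"] assms(1) cmp_id[OF assms(2)]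
    by (auto simp: cmp_cmp f_inv_into_f)
  ultimately show thesis using that by blast
qed

text \<open>With an empty set of function symbols, extensionality leaves the constant
  \<open>undefined\<close> as the only interpretation of functions.\<close>

lemma is_struct_iff: "is_struct \<kappa> \<mu> L M \<longleftrightarrow> small \<kappa> (carrier M) \<and> fun_int M = (\<lambda>_. undefined) \<and>
    rel_int M \<in> extensional Sy \<and> (\<forall>R\<in>Sy. rel_int M R \<subseteq> T (carrier M))"
  by (auto simp: is_struct_def PiE_def Pi_def)

lemma substruct_iff: "substruct \<mu> L M N \<longleftrightarrow> carrier M \<subseteq> carrier N \<and>
    (\<forall>R\<in>Sy. rel_int M R = rel_int N R \<inter> T (carrier M))"
  by (simp add: substruct_def)

lemma struct_iso_iff: "struct_iso \<mu> L h M N \<longleftrightarrow> bij_betw h (carrier M) (carrier N) \<and>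
    (\<forall>R\<in>Sy. \<forall>t\<in>T (carrier M). t \<in> rel_int M R \<longleftrightarrow> cmp h t \<in> rel_int N R)"
  by (simp add: struct_iso_def)

section \<open>Embeddings and induced substructures\<close>

definition embed :: "('u \<Rightarrow> 'u) \<Rightarrow> ('u, 'k, 'u) struct \<Rightarrow> ('u, 'k, 'u) struct \<Rightarrow> bool" where
  "embed h M N \<longleftrightarrow> inj_on h (carrier M) \<and> h ` carrier M \<subseteq> carrier N \<and>
    (\<forall>R\<in>Sy. \<forall>t\<in>T (carrier M). t \<in> rel_int M R \<longleftrightarrow> cmp h t \<in> rel_int N R)"

definition restr :: "('u, 'k, 'u) struct \<Rightarrow> 'u set \<Rightarrow> ('u, 'k, 'u) struct" where
  "restr N Z = \<lparr>carrier = Z, fun_int = \<lambda>_. undefined, rel_int = \<lambda>R\<in>Sy. rel_int N R \<inter> T Z\<rparr>"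

lemma restr_struct: "is_struct \<kappa> \<mu> L N \<Longrightarrow> Z \<subseteq> carrier N \<Longrightarrow> is_struct \<kappa> \<mu> L (restr N Z)"
  using small_subset by (auto simp: is_struct_iff restr_def)

lemma restr_substruct: "Z \<subseteq> carrier N \<Longrightarrow> substruct \<mu> L (restr N Z) N"
  by (auto simp: substruct_iff restr_def)

lemma embed_restr: "embed h M N \<Longrightarrow> struct_iso \<mu> L h M (restr N (h ` carrier M))"
  using cmp_T[of _ "carrier M" h "h ` carrier M"]
  by (auto simp: embed_def struct_iso_iff restr_def bij_betw_def)

lemma struct_iso_embed:
  assumes "struct_iso \<mu> L h M M'" "substruct \<mu> L M' N" shows "embed h M N"
  using assms cmp_T[of _ "carrier M" h "carrier M'"]
  by (auto simp: embed_def struct_iso_iff substruct_iff bij_betw_def)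

lemma substruct_embed:
  assumes "substruct \<mu> L M N" shows "embed (\<lambda>x. x) M N"
  using assms by (auto simp: embed_def substruct_iff cmp_id)

lemma substruct_refl: "is_struct \<kappa> \<mu> L M \<Longrightarrow> substruct \<mu> L M M"
  by (auto simp: is_struct_iff substruct_iff)

lemma T_mono: "X \<subseteq> Y \<Longrightarrow> T X \<subseteq> T Y"
  by (auto simp: tuples_def)

lemma substruct_trans: "substruct \<mu> L M N \<Longrightarrow> substruct \<mu> L N P \<Longrightarrow> substruct \<mu> L M P"
  using T_mono[of "carrier M" "carrier N"] by (auto simp: substruct_iff)

section \<open>Structures that represent objects, and the arrows between them\<close>

definition rep :: "('u, 'k, 'u) struct \<Rightarrow> 'o \<Rightarrow> ('m \<Rightarrow> 'u) \<Rightarrow> bool" where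
  "rep M X h \<longleftrightarrow> X \<in> Obj C \<and> bij_betw h (G X) (carrier M) \<and>
    (\<forall>R\<in>Sy. rel_int M R = {pair_tuple (h x) (h (x \<cdot> dec R)) |x. x \<in> G X \<and> Dom C x = Cod C (dec R)})"

definition coded_class :: "('u, 'k, 'u) struct set" where
  "coded_class = {M. is_struct \<kappa> \<mu> L M \<and> (\<exists>X h. rep M X h)}"

text \<open>By \<open>embed_rep\<close> every embedding between members of the class comes from an
  arrow, so the plain substructure relation already describes the right morphisms.\<close>

definition le :: "('u, 'k, 'u) struct \<Rightarrow> ('u, 'k, 'u) struct \<Rightarrow> bool" where
  "le M N \<longleftrightarrow> M \<in> coded_class \<and> N \<in> coded_class \<and> substruct \<mu> L M N"

lemma dec_arrS: "R \<in> Sy \<Longrightarrow> dec R \<in> arrS"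
  using dec by (auto simp: bij_betw_def)

lemma dec_surj: "g \<in> arrS \<Longrightarrow> \<exists>R\<in>Sy. dec R = g"
  using dec by (metis bij_betw_imp_surj_on imageE)

lemma repD:
  assumes "rep M X h"
  shows "X \<in> Obj C" "inj_on h (G X)" "h ` G X = carrier M"
    "\<And>x. x \<in> G X \<Longrightarrow> h x \<in> carrier M"
    "\<And>R. R \<in> Sy \<Longrightarrow> rel_int M R = {pair_tuple (h x) (h (x \<cdot> dec R)) |x. x \<in> G X \<and> Dom C x = Cod C (dec R)}"
  using assms by (auto simp: rep_def bij_betw_def)

lemma rep_rel:
  assumes M: "rep M X h" and R: "R \<in> Sy" and x: "x \<in> G X" and y: "y \<in> G X"
  shows "pair_tuple (h x) (h y) \<in> rel_int M R \<longleftrightarrow> Dom C x = Cod C (dec R) \<and> y = x \<cdot> dec R"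
proof
  assume "pair_tuple (h x) (h y) \<in> rel_int M R"
  then obtain z where z: "z \<in> G X" "Dom C z = Cod C (dec R)" "h x = h z" "h y = h (z \<cdot> dec R)"
    by (auto simp: repD(5)[OF M R] pair_tuple_eq)
  have "z \<cdot> dec R \<in> G X" using G_arr[OF z(1) dec_arrS[OF R]] z(2) by simp
  then show "Dom C x = Cod C (dec R) \<and> y = x \<cdot> dec R"
    using z x y repD(2)[OF M] by (metis inj_onD)
next
  assume "Dom C x = Cod C (dec R) \<and> y = x \<cdot> dec R"
  then show "pair_tuple (h x) (h y) \<in> rel_int M R" using x by (auto simp: repD(5)[OF M R])
qed

lemma iso_rep:
  assumes M: "rep M X k" and h: "struct_iso \<mu> L h M N" and N: "is_struct \<kappa> \<mu> L N"
  shows "rep N X (h \<circ> k)"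
  unfolding rep_def
proof (intro conjI ballI)
  have b: "bij_betw h (carrier M) (carrier N)" using h by (simp add: struct_iso_iff)
  show "X \<in> Obj C" by (rule repD(1)[OF M])
  show "bij_betw (h \<circ> k) (G X) (carrier N)"
    using M b bij_betw_trans unfolding rep_def by blast
  fix R assume R: "R \<in> Sy"
  have hR: "t \<in> rel_int M R \<longleftrightarrow> cmp h t \<in> rel_int N R" if "t \<in> T (carrier M)" for t
    using h R that by (simp add: struct_iso_iff)
  have prM: "pair_tuple (k x) (k (x \<cdot> dec R)) \<in> T (carrier M)" if "x \<in> G X" "Dom C x = Cod C (dec R)" for x
    using repD(4)[OF M] G_arr[OF that(1) dec_arrS[OF R]] that by (simp add: pair_tuple_T)
  show "rel_int N R = {pair_tuple ((h \<circ> k) x) ((h \<circ> k) (x \<cdot> dec R)) |x. x \<in> G X \<and> Dom C x = Cod C (dec R)}"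
  proof (intro equalityI subsetI)
    fix t assume t: "t \<in> rel_int N R"
    then have "t \<in> T (carrier N)" using N R by (auto simp: is_struct_iff)
    then obtain s where s: "s \<in> T (carrier M)" "cmp h s = t"
      using cmp_surj b unfolding bij_betw_def by metis
    then have "s \<in> rel_int M R" using hR t by blast
    then show "t \<in> {pair_tuple ((h \<circ> k) x) ((h \<circ> k) (x \<cdot> dec R)) |x. x \<in> G X \<and> Dom C x = Cod C (dec R)}"
      using s(2) by (auto simp: repD(5)[OF M R] cmp_pair_tuple)
  next
    fix t assume "t \<in> {pair_tuple ((h \<circ> k) x) ((h \<circ> k) (x \<cdot> dec R)) |x. x \<in> G X \<and> Dom C x = Cod C (dec R)}"
    then obtain x where x: "x \<in> G X" "Dom C x = Cod C (dec R)" "t = cmp h (pair_tuple (k x) (k (x \<cdot> dec R)))"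
      by (auto simp: cmp_pair_tuple)
    then show "t \<in> rel_int N R" using hR[OF prM] by (auto simp: repD(5)[OF M R])
  qed
qed

lemma iso_coded_class: "M \<in> coded_class \<Longrightarrow> struct_iso \<mu> L h M N \<Longrightarrow> is_struct \<kappa> \<mu> L N \<Longrightarrow> N \<in> coded_class"
  unfolding coded_class_def using iso_rep[of M _ _ h N] by blast

text \<open>The image of \<open>h\<close> carries a copy of \<open>M\<close>, and closure under
  isomorphism puts that copy into the class. Morphisms of the class are therefore just
  embeddings.\<close>

lemma embed_coded_class:
  assumes "M \<in> coded_class" "N \<in> coded_class"
  shows "(\<exists>M'. le M' N \<and> struct_iso \<mu> L h M M') \<longleftrightarrow> embed h M N"
proof
  assume "\<exists>M'. le M' N \<and> struct_iso \<mu> L h M M'"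
  then show "embed h M N" using struct_iso_embed by (auto simp: le_def)
next
  assume e: "embed h M N"
  let ?M = "restr N (h ` carrier M)"
  have c: "h ` carrier M \<subseteq> carrier N" using e by (simp add: embed_def)
  have N: "is_struct \<kappa> \<mu> L N" using assms by (simp add: coded_class_def)
  have "is_struct \<kappa> \<mu> L ?M" by (rule restr_struct[OF N c])
  then have "?M \<in> coded_class" by (rule iso_coded_class[OF assms(1) embed_restr[OF e]])
  then show "\<exists>M'. le M' N \<and> struct_iso \<mu> L h M M'"
    using embed_restr[OF e] restr_substruct[OF c] assms(2) by (auto simp: le_def)
qed

text \<open>Injectivity holds because \<open>u \<cdot> x\<close> determines the domain of
  \<open>x\<close> and \<open>u\<close> can be cancelled. For reflection, the first entry of a tuple
  yields an arrow \<open>x\<close> such that the tuple and the related pair built from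
  \<open>x\<close> have the same image under \<open>e\<close>; injectivity identifies them.\<close>

lemma rep_embed:
  assumes M: "rep M X h" and N: "rep N Y k" and u: "u \<in> Hom C X Y"
    and e: "\<And>x. x \<in> G X \<Longrightarrow> e (h x) = k (u \<cdot> x)"
  shows "embed e M N"
  unfolding embed_def
proof (intro conjI ballI)
  note hM = repD[OF M] and kN = repD[OF N]
  have uinj: "x = y" if "x \<in> G X" "y \<in> G X" "u \<cdot> x = u \<cdot> y" for x y
  proof -
    have "Dom C x = Dom C y"
      using Dom_comp[OF G_hom[OF that(1)] u] Dom_comp[OF G_hom[OF that(2)] u] that(3) by simp
    then show ?thesis using cancel[OF u G_hom[OF that(1)]] G_hom[OF that(2)] that(3) by simp
  qed
  show inj: "inj_on e (carrier M)"
  proof (rule inj_onI)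
    fix a b assume a: "a \<in> carrier M" "b \<in> carrier M" "e a = e b"
    then obtain x y where xy: "x \<in> G X" "y \<in> G X" "a = h x" "b = h y" using hM(3) by blast
    then have "k (u \<cdot> x) = k (u \<cdot> y)" using a e by simp
    then have "u \<cdot> x = u \<cdot> y" using kN(2) G_comp[OF _ u] xy by (auto dest: inj_onD)
    then show "a = b" using uinj[OF xy(1,2)] xy(3,4) by simp
  qed
  show "e ` carrier M \<subseteq> carrier N"
    using e kN(4) G_comp[OF _ u] by (auto simp flip: hM(3))
  fix R t assume R: "R \<in> Sy" and t: "t \<in> T (carrier M)"
  note g = dec_arrS[OF R]
  have rel: "e (h (x \<cdot> dec R)) = k (u \<cdot> x \<cdot> dec R)" if "x \<in> G X" "Dom C x = Cod C (dec R)" for x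
    using e[OF G_arr[OF that(1) g]] G_assoc[OF that(1) g _ u] that(2) by simp
  show "t \<in> rel_int M R \<longleftrightarrow> cmp e t \<in> rel_int N R"
  proof
    assume "t \<in> rel_int M R"
    then obtain x where x: "x \<in> G X" "Dom C x = Cod C (dec R)" "t = pair_tuple (h x) (h (x \<cdot> dec R))"
      by (auto simp: hM(5)[OF R])
    then show "cmp e t \<in> rel_int N R"
      using G_comp[OF x(1) u] Dom_comp[OF G_hom[OF x(1)] u]
      by (auto simp: cmp_pair_tuple kN(5)[OF R] rel e)
  next
    assume "cmp e t \<in> rel_int N R"
    then obtain y where y: "y \<in> G Y" "Dom C y = Cod C (dec R)" "cmp e t = pair_tuple (k y) (k (y \<cdot> dec R))"
      by (auto simp: kN(5)[OF R])
    \<comment> \<open>Position \<open>p\<close> differs from \<open>q\<close>, so it holds the first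
      component of the pair.\<close>
    have "t p \<in> carrier M" using t pq by (auto simp: tuples_def)
    then obtain x where x: "x \<in> G X" "t p = h x" using hM(3) by blast
    have "k y = e (t p)" using fun_cong[OF y(3), of p] pq by (simp add: compose_def pair_tuple_def)
    then have "y = u \<cdot> x" using x e kN(2) y(1) G_comp[OF x(1) u] by (auto dest: inj_onD)
    then have dx: "Dom C x = Cod C (dec R)" using y(2) Dom_comp[OF G_hom[OF x(1)] u] by simp
    have "cmp e t = cmp e (pair_tuple (h x) (h (x \<cdot> dec R)))"
      using y(3) \<open>y = u \<cdot> x\<close> x e rel dx by (simp add: cmp_pair_tuple)
    moreover have "pair_tuple (h x) (h (x \<cdot> dec R)) \<in> T (carrier M)"
      using hM(4) x(1) G_arr[OF x(1) g] dx by (simp add: pair_tuple_T)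
    ultimately have "t = pair_tuple (h x) (h (x \<cdot> dec R))" using cmp_inj[OF inj t] by blast
    then show "t \<in> rel_int M R" using x(1) dx by (auto simp: hM(5)[OF R])
  qed
qed

text \<open>Preservation of the symbol of \<open>g\<close> says that the induced map on
  \<open>G X\<close> commutes with precomposition by \<open>g\<close>. The map is thus natural, and
  \<open>G_full\<close> supplies the arrow.\<close>

lemma embed_rep:
  assumes M: "rep M X h" and N: "rep N Y k" and e: "embed e M N"
  obtains u where "u \<in> Hom C X Y" "\<And>x. x \<in> G X \<Longrightarrow> e (h x) = k (u \<cdot> x)"
proof -
  note hM = repD[OF M] and kN = repD[OF N]
  have "\<forall>x\<in>G X. \<exists>y. y \<in> G Y \<and> e (h x) = k y"
    using e hM(4) unfolding embed_def kN(3)[symmetric] by blast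
  then obtain t where t: "\<And>x. x \<in> G X \<Longrightarrow> t x \<in> G Y" "\<And>x. x \<in> G X \<Longrightarrow> e (h x) = k (t x)"
    by metis
  have tR: "Dom C (t x) = Cod C g \<and> t (x \<cdot> g) = t x \<cdot> g" if x: "x \<in> G X" and g: "g \<in> arrS" "Cod C g = Dom C x" for x g
  proof -
    obtain R where R: "R \<in> Sy" "dec R = g" using dec_surj[OF g(1)] by blast
    have xg: "x \<cdot> g \<in> G X" by (rule G_arr[OF x g])
    have "pair_tuple (h x) (h (x \<cdot> g)) \<in> rel_int M R" using rep_rel[OF M R(1) x xg] R(2) g(2) by simp
    then have "cmp e (pair_tuple (h x) (h (x \<cdot> g))) \<in> rel_int N R"
      using e R(1) x xg hM(4) by (simp add: embed_def pair_tuple_T)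
    then have "pair_tuple (k (t x)) (k (t (x \<cdot> g))) \<in> rel_int N R" using t x xg by (simp add: cmp_pair_tuple)
    then show ?thesis using rep_rel[OF N R(1) t(1)[OF x] t(1)[OF xg]] R(2) by simp
  qed
  \<comment> \<open>The symbol of the identity of \<open>Dom C x\<close> relates \<open>x\<close> to
    itself; its preservation pins down the domain of \<open>t x\<close>.\<close>
  have "Dom C (t x) = Dom C x" if x: "x \<in> G X" for x
  proof -
    have "Dom C x \<in> S" using x by (auto simp: G_def)
    then have "Id C (Dom C x) \<in> arrS" "Cod C (Id C (Dom C x)) = Dom C x"
      using id_arrS id_hom S_obj HomD by blast+
    then show ?thesis using tR[OF x] by simp
  qed
  then obtain u where "u \<in> Hom C X Y" "\<And>x. x \<in> G X \<Longrightarrow> t x = u \<cdot> x"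
    using G_full[OF hM(1) kN(1), of t] t(1) tR by metis
  then show thesis using that t(2) by metis
qed

lemma rep_faithful:
  assumes N: "rep N Y k" and u: "u \<in> Hom C X Y" and v: "v \<in> Hom C X Y"
    and eq: "\<And>x. x \<in> G X \<Longrightarrow> k (u \<cdot> x) = k (v \<cdot> x)"
  shows "u = v"
  by (rule G_faithful[OF u v]) (use eq repD(2)[OF N] G_comp u v in \<open>blast dest: inj_onD\<close>)

lemma abstract_class_coded_class: "abstract_class \<kappa> \<mu> L coded_class le"
proof -
  have "|Sy| \<le>o |arrS|" using dec by (auto simp: bij_betw_def intro!: card_of_ordLeqI[of dec])
  then have Sy: "small \<kappa> Sy" using ordLeq_ordLess_trans small_arrS by blast
  have 1: "is_language \<kappa> \<mu> L"
    using Sy small_subset[OF Sy, of "{}"] \<alpha> by (auto simp: is_language_def L_def)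
  have 3: "le M' N'" if "le M N" "is_struct \<kappa> \<mu> L M'" "is_struct \<kappa> \<mu> L N'"
    "struct_iso \<mu> L h N N'" "struct_iso \<mu> L h M M'" for M N M' N' h
  proof -
    have MN: "M \<in> coded_class" "N \<in> coded_class" "substruct \<mu> L M N" using that by (auto simp: le_def)
    have hM: "h ` carrier M = carrier M'" and hN: "h ` carrier N = carrier N'"
      using that(4,5) by (auto simp: struct_iso_iff bij_betw_def)
    have "substruct \<mu> L M' N'"
      unfolding substruct_iff
    proof (intro conjI ballI)
      show "carrier M' \<subseteq> carrier N'" using MN(3) hM hN by (auto simp: substruct_iff)
      fix R assume R: "R \<in> Sy"
      have "t \<in> rel_int M' R \<longleftrightarrow> t \<in> rel_int N' R" if t: "t \<in> T (carrier M')" for t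
      proof -
        obtain s where s: "s \<in> T (carrier M)" "cmp h s = t" using cmp_surj[OF hM t] .
        have sN: "s \<in> T (carrier N)" using s(1) T_mono MN(3) by (auto simp: substruct_iff)
        have "t \<in> rel_int M' R \<longleftrightarrow> s \<in> rel_int M R"
          using \<open>struct_iso \<mu> L h M M'\<close> R s by (auto simp: struct_iso_iff)
        also have "\<dots> \<longleftrightarrow> s \<in> rel_int N R" using MN(3) R s by (auto simp: substruct_iff)
        also have "\<dots> \<longleftrightarrow> t \<in> rel_int N' R"
          using \<open>struct_iso \<mu> L h N N'\<close> R s(2) sN by (auto simp: struct_iso_iff)
        finally show ?thesis .
      qed
      moreover have "rel_int M' R \<subseteq> T (carrier M')" using that(2) R by (auto simp: is_struct_iff)
      ultimately show "rel_int M' R = rel_int N' R \<inter> T (carrier M')" by blast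
    qed
    then show ?thesis
      using iso_coded_class[OF MN(1) that(5,2)] iso_coded_class[OF MN(2) that(4,3)] by (simp add: le_def)
  qed
  show ?thesis
    unfolding abstract_class_def
  proof (intro conjI allI ballI impI)
    show "is_language \<kappa> \<mu> L" by (rule 1)
    show "is_struct \<kappa> \<mu> L M" if "M \<in> coded_class" for M using that by (simp add: coded_class_def)
    show "M \<in> coded_class" "N \<in> coded_class" "substruct \<mu> L M N" if "le M N" for M N using that by (auto simp: le_def)
    show "le M M" if "M \<in> coded_class" for M using that substruct_refl by (auto simp: le_def coded_class_def)
    show "le M P" if "le M N" "le N P" for M N P using that substruct_trans by (auto simp: le_def)
    show "N \<in> coded_class" if "M \<in> coded_class" "is_struct \<kappa> \<mu> L N" "struct_iso \<mu> L h M N" for M N h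
      by (rule iso_coded_class[OF that(1,3,2)])
    show "le M' N'" if "le M N" "is_struct \<kappa> \<mu> L M'" "is_struct \<kappa> \<mu> L N'"
      "struct_iso \<mu> L h N N'" "struct_iso \<mu> L h M M'" for M N M' N' h
      using 3 that .
  qed
qed

section \<open>Unions of directed systems\<close>

lemma union_substruct:
  assumes dir: "directed_poset \<mu> I r" and M: "\<And>i. i \<in> I \<Longrightarrow> is_struct \<kappa> \<mu> L (M i)"
    and le: "\<And>i j. (i, j) \<in> r \<Longrightarrow> substruct \<mu> L (M i) (M j)" and j: "j \<in> I"
  shows "substruct \<mu> L (M j) (union_struct \<mu> L I M)"
proof -
  have "rel_int (M i) R \<inter> T (carrier (M j)) \<subseteq> rel_int (M j) R" if iR: "i \<in> I" "R \<in> Sy" for i R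
  proof -
    \<comment> \<open>A tuple related in \<open>M i\<close> is related in the common extension
      \<open>M k\<close>, and from there the relation descends to \<open>M j\<close>.\<close>
    obtain k where k: "k \<in> I" "(i, k) \<in> r" "(j, k) \<in> r" using directed_pair[OF dir iR(1) j] .
    show ?thesis using le[OF k(2)] le[OF k(3)] iR(2) by (auto simp: substruct_iff)
  qed
  moreover have "rel_int (M j) R \<subseteq> T (carrier (M j))" if "R \<in> Sy" for R
    using M[OF j] that by (simp add: is_struct_iff)
  ultimately show ?thesis using j by (fastforce simp: substruct_iff union_struct_def)
qed

text \<open>The arity is below \<mu>, so the entries of a tuple from the union are spread over fewer
  than \<mu> members of the system, and directedness gives one member \<open>M k\<close> that
  contains them all. There the relation agrees with that of \<open>N\<close>.\<close>

lemma union_least: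
  assumes dir: "directed_poset \<mu> I r" and M: "\<And>i. i \<in> I \<Longrightarrow> substruct \<mu> L (M i) N"
    and le: "\<And>i j. (i, j) \<in> r \<Longrightarrow> substruct \<mu> L (M i) (M j)"
  shows "substruct \<mu> L (union_struct \<mu> L I M) N"
  unfolding substruct_iff
proof (intro conjI ballI)
  let ?U = "union_struct \<mu> L I M"
  show "carrier ?U \<subseteq> carrier N" using M by (auto simp: union_struct_def substruct_iff)
  fix R assume R: "R \<in> Sy"
  have "t \<in> rel_int ?U R" if t: "t \<in> rel_int N R" "t \<in> T (carrier ?U)" for t
  proof -
    have "\<forall>a\<in>underS \<mu> \<alpha>. \<exists>i\<in>I. t a \<in> carrier (M i)"
      using t(2) by (auto simp: tuples_def union_struct_def PiE_def Pi_def)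
    then obtain n where n: "\<And>a. a \<in> underS \<mu> \<alpha> \<Longrightarrow> n a \<in> I \<and> t a \<in> carrier (M (n a))" by metis
    have "|n ` underS \<mu> \<alpha>| <o \<mu>"
      by (rule ordLeq_ordLess_trans[OF card_of_image card_of_underS[OF Card_order_mu \<alpha>]])
    moreover have "n ` underS \<mu> \<alpha> \<subseteq> I" using n by blast
    ultimately obtain k where k: "k \<in> I" "\<forall>i\<in>n ` underS \<mu> \<alpha>. (i, k) \<in> r"
      using directedD(7)[OF dir] by blast
    have "t a \<in> carrier (M k)" if "a \<in> underS \<mu> \<alpha>" for a
      using n[OF that] le[of "n a" k] k(2) that by (auto simp: substruct_iff)
    then have "t \<in> T (carrier (M k))" using t(2) by (auto simp: tuples_def PiE_def Pi_def)
    then have "t \<in> rel_int (M k) R" using M[OF k(1)] R t(1) by (auto simp: substruct_iff)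
    then show ?thesis using k(1) R by (auto simp: union_struct_def)
  qed
  moreover have "rel_int ?U R \<subseteq> rel_int N R \<inter> T (carrier ?U)"
  proof
    fix t assume "t \<in> rel_int ?U R"
    then obtain i where i: "i \<in> I" "t \<in> rel_int (M i) R" using R by (auto simp: union_struct_def)
    then have "t \<in> rel_int N R" "t \<in> T (carrier (M i))" using M[OF i(1)] R by (auto simp: substruct_iff)
    moreover have "carrier (M i) \<subseteq> carrier ?U" using i(1) by (auto simp: union_struct_def)
    ultimately show "t \<in> rel_int N R \<inter> T (carrier ?U)" using T_mono by blast
  qed
  ultimately show "rel_int ?U R = rel_int N R \<inter> T (carrier ?U)" by blast
qed

lemma union_is_struct:
  assumes "small \<kappa> I" and M: "\<And>i. i \<in> I \<Longrightarrow> is_struct \<kappa> \<mu> L (M i)"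
  shows "is_struct \<kappa> \<mu> L (union_struct \<mu> L I M)"
proof -
  have "rel_int (M i) R \<subseteq> T (\<Union>i\<in>I. carrier (M i))" if "i \<in> I" "R \<in> Sy" for i R
  proof -
    have "carrier (M i) \<subseteq> (\<Union>i\<in>I. carrier (M i))" using that by blast
    from T_mono[OF this] show ?thesis using M[OF that(1)] that(2) by (auto simp: is_struct_iff)
  qed
  moreover have "small \<kappa> (\<Union>i\<in>I. carrier (M i))"
    by (rule small_UN[OF assms(1)]) (use M in \<open>simp add: is_struct_iff\<close>)
  ultimately show ?thesis by (auto simp: is_struct_iff union_struct_def)
qed

text \<open>The inclusions of a directed system in \<open>coded_class\<close> lift to a diagram of objects by fullness, and the
  colimit of that diagram represents the union.\<close>

lemma union_rep:
  fixes I :: "'u set"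
  assumes I: "small \<kappa> I" and dir: "directed_poset \<mu> I r" and M: "\<And>i. i \<in> I \<Longrightarrow> M i \<in> coded_class"
    and le: "\<And>i j. (i, j) \<in> r \<Longrightarrow> substruct \<mu> L (M i) (M j)"
  shows "\<exists>c k. rep (union_struct \<mu> L I M) c k"
proof -
  let ?U = "union_struct \<mu> L I M"
  have "\<forall>i. \<exists>X h. i \<in> I \<longrightarrow> rep (M i) X h" using M by (auto simp: coded_class_def)
  then obtain X h where h: "\<And>i. i \<in> I \<Longrightarrow> rep (M i) (X i) (h i)" by metis
  note hD = repD[OF h] and rI = directedD(2,3)[OF dir]
  have "\<forall>i j. \<exists>u. (i, j) \<in> r \<longrightarrow> u \<in> Hom C (X i) (X j) \<and> (\<forall>x\<in>G (X i). h i x = h j (u \<cdot> x))"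
  proof (intro allI)
    fix i j
    show "\<exists>u. (i, j) \<in> r \<longrightarrow> u \<in> Hom C (X i) (X j) \<and> (\<forall>x\<in>G (X i). h i x = h j (u \<cdot> x))"
    proof (cases "(i, j) \<in> r")
      case True
      show ?thesis
        using embed_rep[OF h[OF rI(1)[OF True]] h[OF rI(2)[OF True]] substruct_embed[OF le[OF True]]]
        by metis
    qed simp
  qed
  then obtain D where D: "\<And>i j. (i, j) \<in> r \<Longrightarrow> D i j \<in> Hom C (X i) (X j)"
    "\<And>i j x. (i, j) \<in> r \<Longrightarrow> x \<in> G (X i) \<Longrightarrow> h i x = h j (D i j \<cdot> x)"
    by metis
  \<comment> \<open>Functoriality is checked on elements: identities and composites act there as
    inclusions do, and an arrow is determined by its action.\<close>
  have dia: "diagram C I r X D"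
    unfolding diagram_def
  proof (intro conjI ballI allI impI)
    fix i assume i: "i \<in> I"
    then have ii: "(i, i) \<in> r" by (rule directedD(4)[OF dir])
    show "X i \<in> Obj C" by (rule hD(1)[OF i])
    show "D i i = Id C (X i)"
    proof (rule rep_faithful[OF h[OF i] D(1)[OF ii] id_hom[OF hD(1)[OF i]]])
      fix x assume x: "x \<in> G (X i)"
      show "h i (D i i \<cdot> x) = h i (Id C (X i) \<cdot> x)"
        using D(2)[OF ii x] id_left[OF G_hom[OF x]] by simp
    qed
  next
    show "D i j \<in> Hom C (X i) (X j)" if "(i, j) \<in> r" for i j using D(1)[OF that] .
    fix i j k assume ij: "(i, j) \<in> r" and jk: "(j, k) \<in> r"
    have ik: "(i, k) \<in> r" by (rule directedD(5)[OF dir ij jk])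
    show "D i k = D j k \<cdot> D i j"
    proof (rule rep_faithful[OF h[OF rI(2)[OF jk]] D(1)[OF ik] comp_hom[OF D(1)[OF ij] D(1)[OF jk]]])
      fix x assume x: "x \<in> G (X i)"
      show "h k (D i k \<cdot> x) = h k (D j k \<cdot> D i j \<cdot> x)"
        using D(2)[OF ij x] D(2)[OF ik x] D(2)[OF jk G_comp[OF x D(1)[OF ij]]]
          assoc[OF G_hom[OF x] D(1)[OF ij] D(1)[OF jk]] by simp
    qed
  qed
  obtain c \<phi> where c: "colimit C I r X D c \<phi>" using colimit_exists[OF I dir dia] by blast
  note p = colimitD(2)[OF c]
  \<comment> \<open>An arrow into the colimit is named after any of its factorisations;
    \<open>eqv\<close> makes the choice immaterial.\<close>
  define k where "k f = (SOME z. \<exists>i\<in>I. \<exists>g\<in>G (X i). f = \<phi> i \<cdot> g \<and> z = h i g)" for f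
  \<comment> \<open>Both sides say that \<open>x\<close> and \<open>y\<close> have equal images at a
    later stage. One direction makes \<open>k\<close> well defined, the other makes it
    injective.\<close>
  have eqv: "\<phi> i \<cdot> x = \<phi> j \<cdot> y \<longleftrightarrow> h i x = h j y"
    if ij: "i \<in> I" "j \<in> I" and x: "x \<in> G (X i)" and y: "y \<in> G (X j)" for i j x y
  proof
    assume eq: "\<phi> i \<cdot> x = \<phi> j \<cdot> y"
    then have "Dom C x = Dom C y"
      using Dom_comp[OF G_hom[OF x] p[OF ij(1)]] Dom_comp[OF G_hom[OF y] p[OF ij(2)]] by simp
    then have y': "y \<in> Hom C (Dom C x) (X j)" using G_hom[OF y] by simp
    obtain l where l: "l \<in> I" "(i, l) \<in> r" "(j, l) \<in> r" "D i l \<cdot> x = D j l \<cdot> y"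
      using colimit_representatives[OF dir dia c ij G_hom[OF x] y' eq] .
    show "h i x = h j y" using D(2)[OF l(2) x] D(2)[OF l(3) y] l(4) by simp
  next
    assume eq: "h i x = h j y"
    obtain l where l: "l \<in> I" "(i, l) \<in> r" "(j, l) \<in> r" using directed_pair[OF dir ij] .
    have Dx: "D i l \<cdot> x \<in> G (X l)" "D j l \<cdot> y \<in> G (X l)" using G_comp x y D(1) l by blast+
    have "h l (D i l \<cdot> x) = h l (D j l \<cdot> y)" using D(2)[OF l(2) x] D(2)[OF l(3) y] eq by simp
    then have "D i l \<cdot> x = D j l \<cdot> y" using hD(2)[OF l(1)] Dx by (auto dest: inj_onD)
    then show "\<phi> i \<cdot> x = \<phi> j \<cdot> y"
      using assoc[OF G_hom[OF x] D(1)[OF l(2)] p[OF l(1)]] assoc[OF G_hom[OF y] D(1)[OF l(3)] p[OF l(1)]]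
        colimitD(3)[OF c l(2)] colimitD(3)[OF c l(3)] by simp
  qed
  have k: "k (\<phi> i \<cdot> g) = h i g" if ig: "i \<in> I" "g \<in> G (X i)" for i g
  proof -
    have "\<exists>z. \<exists>j\<in>I. \<exists>g'\<in>G (X j). \<phi> i \<cdot> g = \<phi> j \<cdot> g' \<and> z = h j g'" using ig by blast
    from someI_ex[OF this] obtain j g' where "j \<in> I" "g' \<in> G (X j)" "\<phi> i \<cdot> g = \<phi> j \<cdot> g'" "k (\<phi> i \<cdot> g) = h j g'"
      unfolding k_def[symmetric] by blast
    then show ?thesis using eqv[OF ig(1) _ ig(2)] by simp
  qed
  have fac: "\<exists>i g. i \<in> I \<and> g \<in> G (X i) \<and> x = \<phi> i \<cdot> g \<and> Dom C g = Dom C x" if "x \<in> G c" for x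
    using G_factor[OF I dir dia c that] by metis
  have "rep ?U c k"
    unfolding rep_def
  proof (intro conjI ballI)
    show "c \<in> Obj C" by (rule colimitD(1)[OF c])
    show "bij_betw k (G c) (carrier ?U)"
      unfolding bij_betw_def
    proof
      show "inj_on k (G c)"
      proof (rule inj_onI)
        fix x y assume x: "x \<in> G c" and y: "y \<in> G c" and eq: "k x = k y"
        obtain i f where i: "i \<in> I" "f \<in> G (X i)" "x = \<phi> i \<cdot> f" using fac[OF x] by blast
        obtain j g where j: "j \<in> I" "g \<in> G (X j)" "y = \<phi> j \<cdot> g" using fac[OF y] by blast
        show "x = y" using eq i j k eqv by simp
      qed
      show "k ` G c = carrier ?U"
      proof (intro equalityI subsetI)
        fix z assume "z \<in> k ` G c"
        then obtain x where x: "x \<in> G c" "z = k x" by blast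
        then obtain i f where i: "i \<in> I" "f \<in> G (X i)" "x = \<phi> i \<cdot> f" using fac by blast
        then show "z \<in> carrier ?U" using x(2) k hD(4)[OF i(1,2)] by (auto simp: union_struct_def)
      next
        fix z assume "z \<in> carrier ?U"
        then obtain i where i: "i \<in> I" "z \<in> carrier (M i)" by (auto simp: union_struct_def)
        then obtain g where g: "g \<in> G (X i)" "z = h i g" using hD(3)[OF i(1)] by blast
        then have "z = k (\<phi> i \<cdot> g)" using k i(1) by simp
        then show "z \<in> k ` G c" using G_comp[OF g(1) p[OF i(1)]] by blast
      qed
    qed
    fix R assume R: "R \<in> Sy"
    have kr: "k (\<phi> i \<cdot> g \<cdot> dec R) = h i (g \<cdot> dec R)" if "i \<in> I" "g \<in> G (X i)" "Dom C g = Cod C (dec R)" for i g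
      using G_assoc[OF that(2) dec_arrS[OF R] _ p[OF that(1)]] that(3)
        k[OF that(1) G_arr[OF that(2) dec_arrS[OF R]]] by simp
    have "rel_int ?U R = (\<Union>i\<in>I. rel_int (M i) R)" using R by (simp add: union_struct_def)
    also have "\<dots> = {pair_tuple (k x) (k (x \<cdot> dec R)) |x. x \<in> G c \<and> Dom C x = Cod C (dec R)}"
    proof (intro equalityI subsetI)
      fix t assume "t \<in> (\<Union>i\<in>I. rel_int (M i) R)"
      then obtain i g where i: "i \<in> I" "g \<in> G (X i)" "Dom C g = Cod C (dec R)" "t = pair_tuple (h i g) (h i (g \<cdot> dec R))"
        using hD(5)[OF _ R] by blast
      have "t = pair_tuple (k (\<phi> i \<cdot> g)) (k (\<phi> i \<cdot> g \<cdot> dec R))" using k[OF i(1,2)] kr[OF i(1-3)] i(4) by simp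
      moreover have "Dom C (\<phi> i \<cdot> g) = Cod C (dec R)" using Dom_comp[OF G_hom[OF i(2)] p[OF i(1)]] i(3) by simp
      ultimately show "t \<in> {pair_tuple (k x) (k (x \<cdot> dec R)) |x. x \<in> G c \<and> Dom C x = Cod C (dec R)}"
        using G_comp[OF i(2) p[OF i(1)]] by blast
    next
      fix t assume "t \<in> {pair_tuple (k x) (k (x \<cdot> dec R)) |x. x \<in> G c \<and> Dom C x = Cod C (dec R)}"
      then obtain x where x: "x \<in> G c" "Dom C x = Cod C (dec R)" "t = pair_tuple (k x) (k (x \<cdot> dec R))" by blast
      obtain i g where i: "i \<in> I" "g \<in> G (X i)" "x = \<phi> i \<cdot> g" "Dom C g = Dom C x" using fac[OF x(1)] by blast
      have dg: "Dom C g = Cod C (dec R)" using i(4) x(2) by simp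
      have "t = pair_tuple (h i g) (h i (g \<cdot> dec R))" using x(3) i(3) k[OF i(1,2)] kr[OF i(1,2) dg] by simp
      then have "t \<in> rel_int (M i) R" unfolding hD(5)[OF i(1) R] using i(2) dg by blast
      then show "t \<in> (\<Union>i\<in>I. rel_int (M i) R)" using i(1) by blast
    qed
    finally show "rel_int ?U R = {pair_tuple (k x) (k (x \<cdot> dec R)) |x. x \<in> G c \<and> Dom C x = Cod C (dec R)}" .
  qed
  then show ?thesis by blast
qed

section \<open>Canonical structures and the Loewenheim-Skolem-Tarski axiom\<close>

definition enc :: "'o \<Rightarrow> 'm \<Rightarrow> 'u" where
  "enc X = (SOME e. inj_on e (G X))"

definition str :: "'o \<Rightarrow> ('u, 'k, 'u) struct" where
  "str X = \<lparr>carrier = enc X ` G X, fun_int = \<lambda>_. undefined,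
     rel_int = \<lambda>R\<in>Sy. {pair_tuple (enc X x) (enc X (x \<cdot> dec R)) |x. x \<in> G X \<and> Dom C x = Cod C (dec R)}\<rparr>"

lemma enc_inj: assumes "X \<in> Obj C" shows "inj_on (enc X) (G X)"
proof -
  obtain e :: "'m \<Rightarrow> 'u" where "inj_on e (G X)" using small_embedding[OF small_G[OF assms]] .
  then show ?thesis unfolding enc_def by (rule someI[of "\<lambda>e. inj_on e (G X)"])
qed

lemma str_rep: "X \<in> Obj C \<Longrightarrow> rep (str X) X (enc X)"
  by (simp add: rep_def str_def bij_betw_def enc_inj)

lemma str_coded_class: assumes "X \<in> Obj C" shows "str X \<in> coded_class"
proof -
  have "is_struct \<kappa> \<mu> L (str X)"
    using small_image[OF small_G[OF assms]] dec_arrS G_arr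
    by (auto simp: is_struct_iff str_def pair_tuple_T)
  then show ?thesis using str_rep[OF assms] by (auto simp: coded_class_def)
qed

text \<open>The bound \<open>pow_less (card_of A) \<mu> +c l\<close> is closed under powers <\<mu>
  and lies above \<mu> and the number of arrows, so \<open>G_downward\<close> applies with this very
  bound. The type of \<open>l\<close> is left open because the statement is wanted both for
  \<lambda> and for a copy of it on \<open>'u\<close>.\<close>

lemma LST_coded_class:
  assumes l: "Card_order l" "l <o \<kappa>" "pow_less l \<mu> =o l" "\<mu> \<le>o l" "|arrS| \<le>o l"
  shows "LST_number \<kappa> \<mu> L coded_class le l"
proof -
  have li: "Cinfinite l" using cinfinite_mono[OF l(4)] Cinfinite_mu l(1) by blast
  have "|({} :: 'u set) <+> Sy| \<le>o |arrS|"
    using dec by (auto intro!: card_of_ordLeqI[of "\<lambda>z. dec (projr z)"] simp: bij_betw_def inj_on_def)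
  then have "language_card L \<le>o l"
    using ordLeq_transitive[OF _ l(5)] by (simp add: language_card_def)
  then have lc: "language_card L +c \<mu> \<le>o l"
    using l(4) li Card_order_mu by (intro csum_cinfinite_bound) (auto simp: language_card_def card_of_Card_order)
  have "\<exists>N. le N M \<and> A \<subseteq> carrier N \<and> |carrier N| \<le>o pow_less (card_of A) \<mu> +c l"
    if M: "M \<in> coded_class" and A: "A \<subseteq> carrier M" for M A
  proof -
    let ?b = "pow_less (card_of A) \<mu> +c l"
    have bc: "Card_order ?b" by (rule Card_order_csum)
    have lb: "l \<le>o ?b" by (rule ordLeq_csum2[OF l(1)])
    have pb: "pow_less ?b \<mu> \<le>o ?b" by (rule pow_less_csum_closed[OF card_of_Card_order l(1,4,3)])
    have Ab: "|A| \<le>o ?b"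
      by (rule ordLeq_transitive[OF pow_less_upper[OF card_of_Card_order] ordLeq_csum1[OF Card_order_pow_less]])
    obtain X h where h: "rep M X h" using M by (auto simp: coded_class_def)
    note hD = repD[OF h]
    define B where "B = {x \<in> G X. h x \<in> A}"
    have B: "B \<subseteq> G X" "h ` B = A" using A hD(3) by (auto simp: B_def)
    have "|B| \<le>o |A|"
      by (rule card_of_ordLeqI[of h]) (auto simp: B_def intro: inj_on_subset[OF hD(2)])
    then have Bb: "|B| \<le>o ?b" by (rule ordLeq_transitive[OF _ Ab])
    obtain Y u where u: "u \<in> Hom C Y X" "B \<subseteq> (\<lambda>y. u \<cdot> y) ` G Y" "|G Y| \<le>o ?b"
      using G_downward[OF hD(1) B(1) Bb bc ordLeq_transitive[OF l(4) lb] pb ordLeq_transitive[OF l(5) lb]] .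
    have Y: "Y \<in> Obj C" using hom_objs u(1) by blast
    \<comment> \<open>The action of \<open>u\<close>, with elements of \<open>str Y\<close> decoded
      by inverting \<open>enc Y\<close>; its image will be the substructure
      \<open>N\<close>.\<close>
    define e where "e z = h (u \<cdot> inv_into (G Y) (enc Y) z)" for z
    have e: "e (enc Y y) = h (u \<cdot> y)" if "y \<in> G Y" for y
      using that enc_inj[OF Y] by (simp add: e_def)
    have "embed e (str Y) M" using rep_embed[OF str_rep[OF Y] h u(1)] e by blast
    then obtain N where N: "le N M" "struct_iso \<mu> L e (str Y) N"
      using embed_coded_class[OF str_coded_class[OF Y] M] by blast
    have "carrier N = e ` enc Y ` G Y" using N(2) by (simp add: struct_iso_iff bij_betw_def str_def)
    then have cN: "carrier N = h ` (\<lambda>y. u \<cdot> y) ` G Y" using e by (simp add: image_image)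
    then have "A \<subseteq> carrier N" using u(2) B(2) by blast
    moreover have "|carrier N| \<le>o ?b"
      unfolding cN by (rule ordLeq_transitive[OF card_of_image ordLeq_transitive[OF card_of_image u(3)]])
    ultimately show ?thesis using N(1) by blast
  qed
  then show ?thesis using l(1,2) ordIso_symmetric[OF l(3)] lc by (simp add: LST_number_def)
qed

lemma mu_AEC_coded_class:
  assumes "LST_number \<kappa> \<mu> L coded_class le (l :: 'u rel)"
  shows "mu_AEC \<kappa> \<mu> L coded_class le"
  unfolding mu_AEC_def
proof (intro conjI allI impI)
  show "abstract_class \<kappa> \<mu> L coded_class le" by (rule abstract_class_coded_class)
  show "le M\<^sub>0 M\<^sub>1" if "le M\<^sub>0 M\<^sub>2" "le M\<^sub>1 M\<^sub>2" "substruct \<mu> L M\<^sub>0 M\<^sub>1" for M\<^sub>0 M\<^sub>1 M\<^sub>2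
    using that by (simp add: le_def)
  show "\<exists>l :: 'u rel. LST_number \<kappa> \<mu> L coded_class le l" using assms by blast
next
  fix I :: "'u set" and r and M :: "'u \<Rightarrow> ('u, 'k, 'u) struct"
  assume I: "small \<kappa> I" "directed_poset \<mu> I r" and M: "\<forall>i\<in>I. M i \<in> coded_class"
    and le: "\<forall>i j. (i, j) \<in> r \<longrightarrow> le (M i) (M j)"
  let ?U = "union_struct \<mu> L I M"
  have st: "is_struct \<kappa> \<mu> L (M i)" if "i \<in> I" for i using M that by (simp add: coded_class_def)
  have sub: "substruct \<mu> L (M i) (M j)" if "(i, j) \<in> r" for i j using le that by (simp add: le_def)
  have "\<exists>c k. rep ?U c k" using union_rep[OF I] M sub by blast
  then show U: "?U \<in> coded_class" using union_is_struct[OF I(1) st] by (simp add: coded_class_def)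
  show "\<forall>j\<in>I. le (M j) ?U"
    using union_substruct[of I r M] I(2) st sub M U by (simp add: le_def)
  show "\<forall>N\<in>coded_class. (\<forall>i\<in>I. le (M i) N) \<longrightarrow> le ?U N"
    using union_least[OF I(2) _ sub] U by (simp add: le_def)
qed

section \<open>The functor from objects to structures\<close>

abbreviation "E \<equiv> AEC_cat \<mu> L coded_class le"

lemma AEC_hom: "z \<in> Hom E M N \<longleftrightarrow> M \<in> coded_class \<and> N \<in> coded_class \<and>
    (\<exists>h. z = (M, h, N) \<and> h \<in> extensional (carrier M) \<and> embed h M N)"
  using embed_coded_class[of M N] by (cases z) (simp add: Hom_def AEC_cat_def, blast)

text \<open>Restricted to the carrier because arrows of \<open>AEC_cat\<close> are extensional
  maps.\<close>

definition act :: "'m \<Rightarrow> 'u \<Rightarrow> 'u" where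
  "act f = (\<lambda>z\<in>carrier (str (Dom C f)). enc (Cod C f) (f \<cdot> inv_into (G (Dom C f)) (enc (Dom C f)) z))"

lemma carrier_str: "carrier (str X) = enc X ` G X"
  by (simp add: str_def)

lemma act_enc: "f \<in> Hom C X Y \<Longrightarrow> x \<in> G X \<Longrightarrow> act f (enc X x) = enc Y (f \<cdot> x)"
  using enc_inj[of X] hom_objs[of f X Y] HomD[of f X Y] by (simp add: act_def carrier_str)

lemma act_ext: "f \<in> Hom C X Y \<Longrightarrow> act f \<in> extensional (carrier (str X))"
  using HomD[of f X Y] by (simp add: act_def)

lemma act_embed: "f \<in> Hom C X Y \<Longrightarrow> embed (act f) (str X) (str Y)"
  using rep_embed[OF str_rep str_rep, of X Y f "act f"] hom_objs[of f X Y] act_enc by blast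

text \<open>Fullness is \<open>embed_rep\<close> and faithfulness is \<open>rep_faithful\<close>,
  read on canonical structures.\<close>

lemma equivalence: "equivalent_categories C E"
  unfolding equivalent_categories_def
proof (intro exI conjI ballI)
  let ?F = "\<lambda>f. (str (Dom C f), act f, str (Cod C f))"
  have F: "?F f = (str X, act f, str Y)" if "f \<in> Hom C X Y" for f X Y
    using HomD[OF that] by simp
  have F_hom: "?F f \<in> Hom E (str X) (str Y)" if f: "f \<in> Hom C X Y" for f X Y
    unfolding F[OF f] AEC_hom using str_coded_class hom_objs[OF f] act_ext[OF f] act_embed[OF f] by blast
  show "is_functor C E str ?F"
    unfolding is_functor_def
  proof (intro conjI ballI impI)
    show "str X \<in> Obj E" if "X \<in> Obj C" for X using str_coded_class[OF that] by (simp add: AEC_cat_def)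
    show "?F f \<in> Hom E (str (Dom C f)) (str (Cod C f))" if "f \<in> Arr C" for f
      using that by (intro F_hom) (simp add: Hom_def)
    show "?F (Id C X) = Id E (str X)" if X: "X \<in> Obj C" for X
    proof -
      have "act (Id C X) = (\<lambda>z\<in>carrier (str X). z)"
      proof (rule extensionalityI[OF act_ext[OF id_hom[OF X]]])
        fix z assume "z \<in> carrier (str X)"
        then obtain x where x: "x \<in> G X" "z = enc X x" by (auto simp: carrier_str)
        then show "act (Id C X) z = (\<lambda>z\<in>carrier (str X). z) z"
          using act_enc[OF id_hom[OF X] x(1)] id_left[OF G_hom[OF x(1)]] by (simp add: carrier_str)
      qed simp
      then show ?thesis using F[OF id_hom[OF X]] by (simp add: AEC_cat_def)
    qed
    fix f g assume f: "f \<in> Arr C" and g: "g \<in> Arr C" and fg: "Dom C g = Cod C f"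
    let ?X = "Dom C f" and ?Y = "Cod C f" and ?Z = "Cod C g"
    have f': "f \<in> Hom C ?X ?Y" and g': "g \<in> Hom C ?Y ?Z" using f g fg by (auto simp: Hom_def)
    note gf = comp_hom[OF f' g']
    have "act (g \<cdot> f) = compose (carrier (str ?X)) (act g) (act f)"
    proof (rule extensionalityI[OF act_ext[OF gf]])
      fix z assume "z \<in> carrier (str ?X)"
      then obtain x where x: "x \<in> G ?X" "z = enc ?X x" by (auto simp: carrier_str)
      then show "act (g \<cdot> f) z = compose (carrier (str ?X)) (act g) (act f) z"
        using act_enc[OF gf x(1)] act_enc[OF f' x(1)] act_enc[OF g' G_comp[OF x(1) f']]
          assoc[OF G_hom[OF x(1)] f' g'] by (simp add: compose_def carrier_str)
    qed (simp add: compose_def)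
    then show "?F (g \<cdot> f) = Comp E (?F g) (?F f)" using F[OF gf] by (simp add: AEC_cat_def)
  qed
  show "inj_on ?F (Hom C X Y)" if "X \<in> Obj C" "Y \<in> Obj C" for X Y
  proof (rule inj_onI)
    fix f g assume f: "f \<in> Hom C X Y" and g: "g \<in> Hom C X Y" and eq: "?F f = ?F g"
    show "f = g"
    proof (rule rep_faithful[OF str_rep[OF that(2)] f g])
      show "enc Y (f \<cdot> x) = enc Y (g \<cdot> x)" if "x \<in> G X" for x
        using act_enc[OF f that] act_enc[OF g that] eq by simp
    qed
  qed
  show "Hom E (str X) (str Y) \<subseteq> ?F ` Hom C X Y" if X: "X \<in> Obj C" and Y: "Y \<in> Obj C" for X Y
  proof
    fix z assume "z \<in> Hom E (str X) (str Y)"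
    then obtain h where h: "z = (str X, h, str Y)" "h \<in> extensional (carrier (str X))" "embed h (str X) (str Y)"
      by (auto simp: AEC_hom)
    obtain u where u: "u \<in> Hom C X Y" "\<And>x. x \<in> G X \<Longrightarrow> h (enc X x) = enc Y (u \<cdot> x)"
      using embed_rep[OF str_rep[OF X] str_rep[OF Y] h(3)] by metis
    have "h = act u"
      by (rule extensionalityI[OF h(2) act_ext[OF u(1)]]) (auto simp: carrier_str u(2) act_enc[OF u(1)])
    then show "z \<in> ?F ` Hom C X Y" using h(1) u(1) F[OF u(1)] by (intro image_eqI[of _ _ u]) auto
  qed
  fix N assume "N \<in> Obj E"
  then have N: "N \<in> coded_class" by (simp add: AEC_cat_def)
  then obtain X k where k: "rep N X k" by (auto simp: coded_class_def)
  note kD = repD[OF k]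
  note s = str_rep[OF kD(1)] and sK = str_coded_class[OF kD(1)] and i = id_hom[OF kD(1)]
  \<comment> \<open>\<open>str X\<close> and \<open>N\<close> are two copies of one object. Renaming
    along \<open>enc X\<close> and \<open>k\<close> is the identity of \<open>X\<close> in the sense
    of \<open>rep_embed\<close>, so both directions are embeddings.\<close>
  let ?f = "\<lambda>z\<in>carrier (str X). k (inv_into (G X) (enc X) z)"
  let ?g = "\<lambda>z\<in>carrier N. enc X (inv_into (G X) k z)"
  have f: "?f (enc X x) = k x" and g: "?g (k x) = enc X x" if "x \<in> G X" for x
    using that enc_inj[OF kD(1)] kD(2,4) by (auto simp: carrier_str)
  have il: "Id C X \<cdot> x = x" if "x \<in> G X" for x using id_left[OF G_hom[OF that]] .
  have "embed ?f (str X) N" using rep_embed[OF s k i] f il by presburger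
  moreover have "embed ?g N (str X)" using rep_embed[OF k s i] g il by presburger
  ultimately have hom: "(str X, ?f, N) \<in> Hom E (str X) N" "(N, ?g, str X) \<in> Hom E N (str X)"
    using N sK by (auto simp: AEC_hom)
  have "compose (carrier (str X)) ?g ?f = (\<lambda>z\<in>carrier (str X). z)"
    by (rule extensionalityI[where A = "carrier (str X)"])
      (use enc_inj[OF kD(1)] kD(2,4) in \<open>auto simp: compose_def carrier_str\<close>)
  moreover have "compose (carrier N) ?f ?g = (\<lambda>z\<in>carrier N. z)"
    by (rule extensionalityI[where A = "carrier N"])
      (use enc_inj[OF kD(1)] kD(2) in \<open>auto simp: compose_def carrier_str dest: inj_onD simp flip: kD(3)\<close>)
  ultimately have "isomorphic_objects E (str X) N"
    unfolding isomorphic_objects_def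
    by (intro bexI[OF _ hom(1)] bexI[OF _ hom(2)]) (simp add: AEC_cat_def)
  then show "\<exists>x\<in>Obj C. isomorphic_objects E (str x) N" using kD(1) by blast
qed

end

section \<open>The equivalence for accessible categories\<close>

lemma isomorphic_full_subcategory:
  assumes "x \<in> P" "y \<in> P"
  shows "isomorphic_objects (full_subcategory C P) x y \<longleftrightarrow> isomorphic_objects C x y"
proof -
  have "Hom (full_subcategory C P) a b = Hom C a b" if "a \<in> P" "b \<in> P" for a b
    using that by (auto simp: Hom_def full_subcategory_def)
  then show ?thesis using assms by (simp add: isomorphic_objects_def full_subcategory_def)
qed

text \<open>When all morphisms are monomorphisms, a retract is an isomorphism. Hence every presentable
  object is isomorphic to a member of any generating set, so that the skeleton is small.\<close>

lemma skeleton_dense: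
  fixes \<kappa> :: "'u rel" and \<mu> :: "'k rel" and K A :: "('o, 'm) cat"
  assumes \<mu>: "regular_cardinal \<mu>" and u: "universe_for \<kappa> \<mu>" and acc: "accessible \<kappa> \<mu> K"
    and mono: "\<forall>f\<in>Arr K. monomorphism K f"
    and sk: "skeleton_of A (full_subcategory K {M. presentable \<kappa> \<mu> K M})"
  obtains S where "dense_mono_cat \<kappa> \<mu> K S" "Arr A = {f \<in> Arr K. Dom K f \<in> S \<and> Cod K f \<in> S}"
proof -
  interpret mono_cat K
    using acc mono by unfold_locales (simp_all add: accessible_def)
  let ?P = "{M. presentable \<kappa> \<mu> K M}"
  have ls: "locally_small \<kappa> K" using acc by (simp add: accessible_def)
  note acc' = acc[unfolded accessible_def]
  obtain \<A> where \<A>': "small \<kappa> \<A> \<and> (\<forall>M\<in>\<A>. presentable \<kappa> \<mu> K M) \<and>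
      (\<forall>x\<in>Obj K. \<exists>(I :: 'u set) r D\<^sub>0 D\<^sub>1 \<phi>. small \<kappa> I \<and> directed_poset \<mu> I r \<and>
        diagram K I r D\<^sub>0 D\<^sub>1 \<and> D\<^sub>0 ` I \<subseteq> \<A> \<and> colimit K I r D\<^sub>0 D\<^sub>1 x \<phi>)"
    using acc'[THEN conjunct2, THEN conjunct2, THEN conjunct2] by (rule exE)
  have \<A>: "small \<kappa> \<A>" "\<A> \<subseteq> ?P" using \<A>' by auto
  note dense = \<A>'[THEN conjunct2, THEN conjunct2, THEN bspec]
  obtain S where S: "S \<subseteq> ?P" and A: "A = full_subcategory (full_subcategory K ?P) S"
    and ex1: "\<And>x. x \<in> ?P \<Longrightarrow> \<exists>!s. s \<in> S \<and> isomorphic_objects (full_subcategory K ?P) x s"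
  proof -
    have "Obj (full_subcategory K ?P) = ?P" by (simp add: full_subcategory_def)
    then show thesis using sk that unfolding skeleton_of_def by metis
  qed
  have ex1': "\<exists>!s. s \<in> S \<and> isomorphic_objects K x s" if "x \<in> ?P" for x
  proof -
    have "s \<in> S \<and> isomorphic_objects (full_subcategory K ?P) x s \<longleftrightarrow> s \<in> S \<and> isomorphic_objects K x s" for s
      using isomorphic_full_subcategory[OF that, of s] S by blast
    then show ?thesis using ex1[OF that] by simp
  qed
  have PO: "?P \<subseteq> Obj K" by (auto simp: presentable_def)
  have retract: "\<exists>a\<in>\<A>. isomorphic_objects K M a" if M: "M \<in> ?P" for M
  proof -
    have MO: "M \<in> Obj K" using M PO by blast
    obtain I :: "'u set" and r D\<^sub>0 D\<^sub>1 \<phi> where D: "small \<kappa> I" "directed_poset \<mu> I r"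
      "diagram K I r D\<^sub>0 D\<^sub>1" "D\<^sub>0 ` I \<subseteq> \<A>" "colimit K I r D\<^sub>0 D\<^sub>1 M \<phi>"
      using dense[OF MO] by blast
    obtain i g where i: "i \<in> I" and g: "g \<in> Hom K M (D\<^sub>0 i)" "Id K M = Comp K (\<phi> i) g"
      using presentable_factor[OF ls _ D(1,2,3,5) id_hom[OF MO]] M by blast
    note p = colimitD(2)[OF D(5) i]
    have "Comp K g (\<phi> i) = Id K (D\<^sub>0 i)" by (rule split_epi[OF p g(1) g(2)[symmetric]])
    then have "isomorphic_objects K M (D\<^sub>0 i)"
      unfolding isomorphic_objects_def using p g(1) g(2)[symmetric] by blast
    then show ?thesis using D(4) i by blast
  qed
  then obtain n where n: "\<And>M. M \<in> ?P \<Longrightarrow> n M \<in> \<A> \<and> isomorphic_objects K M (n M)" by metis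
  \<comment> \<open>Members of \<open>S\<close> with a common image are isomorphic to it, hence to
    each other, and a skeleton meets each isomorphism class once. So \<open>S\<close> is no larger
    than the generating set.\<close>
  have "inj_on n S"
  proof (rule inj_onI)
    fix s t assume st: "s \<in> S" "t \<in> S" "n s = n t"
    then have "isomorphic_objects K s t"
      using n[of s] n[of t] S isomorphic_trans[of s "n s" t] isomorphic_sym[of t "n t"] by auto
    moreover have "isomorphic_objects K s s" using isomorphic_refl st(1) S PO by blast
    ultimately show "s = t" using ex1'[of s] st(1,2) S by blast
  qed
  then have "|S| \<le>o |\<A>|" by (rule card_of_ordLeqI) (use n S in blast)
  then have smallS: "small \<kappa> S" by (rule ordLeq_ordLess_trans[OF _ \<A>(1)])
  have "dense_mono_cat \<kappa> \<mu> K S"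
  proof unfold_locales
    show "regular_cardinal \<mu>" "universe_for \<kappa> \<mu>" "locally_small \<kappa> K" "small \<kappa> S" by fact+
    show "S \<subseteq> Obj K" using S PO by blast
    show "\<exists>c \<phi>. colimit K I r D\<^sub>0 D\<^sub>1 c \<phi>" if "small \<kappa> I" "directed_poset \<mu> I r" "diagram K I r D\<^sub>0 D\<^sub>1"
      for I :: "'u set" and r D\<^sub>0 D\<^sub>1
      using acc'[THEN conjunct2, THEN conjunct2, THEN conjunct1] that by meson
    show "\<exists>i\<in>I. \<exists>g\<in>Hom K a (D\<^sub>0 i). f = Comp K (\<phi> i) g"
      if "a \<in> S" "small \<kappa> I" "directed_poset \<mu> I r" "diagram K I r D\<^sub>0 D\<^sub>1" "colimit K I r D\<^sub>0 D\<^sub>1 c \<phi>" "f \<in> Hom K a c"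
      for a and I :: "'u set" and r D\<^sub>0 D\<^sub>1 c \<phi> f
      using presentable_factor[OF ls _ that(2-6)] that(1) S by blast
    show "\<exists>(I :: 'u set) r D\<^sub>0 D\<^sub>1 \<phi>. small \<kappa> I \<and> directed_poset \<mu> I r \<and> diagram K I r D\<^sub>0 D\<^sub>1 \<and> D\<^sub>0 ` I \<subseteq> S \<and>
      colimit K I r D\<^sub>0 D\<^sub>1 x \<phi>" if "x \<in> Obj K" for x
    proof -
      obtain I :: "'u set" and r D\<^sub>0 D\<^sub>1 \<phi> where D: "small \<kappa> I" "directed_poset \<mu> I r"
        "diagram K I r D\<^sub>0 D\<^sub>1" "D\<^sub>0 ` I \<subseteq> \<A>" "colimit K I r D\<^sub>0 D\<^sub>1 x \<phi>"
        using dense[OF \<open>x \<in> Obj K\<close>] by blast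
      have rI: "r \<subseteq> I \<times> I" using D(2) by (simp add: directed_poset_def)
      \<comment> \<open>The generating objects are presentable, hence isomorphic to members of
        \<open>S\<close>; the diagram is replaced index by index.\<close>
      have "\<exists>e s t. i \<in> I \<longrightarrow> e \<in> S \<and> s \<in> Hom K e (D\<^sub>0 i) \<and> t \<in> Hom K (D\<^sub>0 i) e \<and>
          Comp K s t = Id K (D\<^sub>0 i) \<and> Comp K t s = Id K e" for i
      proof (cases "i \<in> I")
        case True
        then have "D\<^sub>0 i \<in> ?P" using D(4) \<A>(2) by blast
        then obtain e where "e \<in> S" "isomorphic_objects K (D\<^sub>0 i) e" using ex1' by blast
        then show ?thesis unfolding isomorphic_objects_def by blast
      qed simp
      then obtain e s t where est: "\<And>i. i \<in> I \<Longrightarrow> e i \<in> S \<and> s i \<in> Hom K (e i) (D\<^sub>0 i) \<and> t i \<in> Hom K (D\<^sub>0 i) (e i) \<and>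
          Comp K (s i) (t i) = Id K (D\<^sub>0 i) \<and> Comp K (t i) (s i) = Id K (e i)" by metis
      note iso = colimit_iso_diagram[OF D(5,3) rI, of s e t]
      have "diagram K I r e (\<lambda>i j. Comp K (t j) (Comp K (D\<^sub>1 i j) (s i)))" using iso(1) est by blast
      moreover have "colimit K I r e (\<lambda>i j. Comp K (t j) (Comp K (D\<^sub>1 i j) (s i))) x (\<lambda>i. Comp K (\<phi> i) (s i))" using iso(2) est by blast
      moreover have "e ` I \<subseteq> S" using est by blast
      ultimately show ?thesis using D(1,2) by blast
    qed
  qed
  moreover have "Arr A = {f \<in> Arr K. Dom K f \<in> S \<and> Cod K f \<in> S}"
    using S by (auto simp: A full_subcategory_def)
  ultimately show thesis using that by blast
qed

text \<open>The assumption on the universe speaks of subsets of \<open>'u\<close> only, so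
  \<open>m\<close> is first copied onto such a subset.\<close>

lemma (in dense_mono_cat) pow_less_small:
  assumes "Card_order m" "m <o \<kappa>" shows "pow_less m \<mu> <o \<kappa>"
proof -
  have "|Field m| \<le>o \<kappa>"
    by (rule ordIso_ordLeq_trans[OF card_of_Field_ordIso[OF assms(1)] ordLess_imp_ordLeq[OF assms(2)]])
  then obtain X :: "'u set" where X: "|Field m| =o |X|"
    using iffD1[OF internalize_card_of_ordLeq] by blast
  have mX: "m =o |X|" by (rule ordIso_transitive[OF ordIso_symmetric[OF card_of_Field_ordIso[OF assms(1)]] X])
  then have "small \<kappa> X" using ordIso_ordLess_trans[OF ordIso_symmetric assms(2)] by blast
  then have "pow_less (card_of X) \<mu> <o \<kappa>" using universe by (simp add: universe_for_def)
  then show ?thesis by (rule ordIso_ordLess_trans[OF pow_less_cong[OF mX]])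
qed

theorem theorem4p10:
  fixes \<kappa> :: "'u rel" and \<mu> :: "'k rel"
    and K :: "('o, 'm) cat" and A :: "('o, 'm) cat"
  assumes "regular_cardinal \<mu>"
    and "universe_for \<kappa> \<mu>"
    and "accessible \<kappa> \<mu> K"
    and "\<forall>f\<in>Arr K. monomorphism K f"
    and "skeleton_of A (full_subcategory K {M. presentable \<kappa> \<mu> K M})"
  shows "\<exists>(L :: ('u, 'k) language) (\<K> :: ('u, 'k, 'u) struct set) le.
           mu_AEC \<kappa> \<mu> L \<K> le \<and>
           equivalent_categories K (AEC_cat \<mu> L \<K> le) \<and>
           LST_number \<kappa> \<mu> L \<K> le (pow_less (card_max \<mu> (card_of (Arr A))) \<mu>)"
proof -
  obtain S where S: "dense_mono_cat \<kappa> \<mu> K S" "Arr A = {f \<in> Arr K. Dom K f \<in> S \<and> Cod K f \<in> S}"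
    using skeleton_dense[OF assms] .
  interpret dense_mono_cat \<kappa> \<mu> K S by (rule S(1))
  have A: "Arr A = arrS" using S(2) by (simp add: arrS_def)
  obtain e :: "'m \<Rightarrow> 'u" where e: "inj_on e arrS" using small_embedding[OF small_arrS] .
  \<comment> \<open>The ordinal 2, found as an element whose predecessors are in bijection with
    \<open>bool\<close>; the symbols become binary.\<close>
  obtain \<alpha> f where \<alpha>: "\<alpha> \<in> Field \<mu>" "bij_betw f (underS \<mu> \<alpha>) (UNIV :: bool set)"
    using length_exists[OF finite_less[OF finite_UNIV]] .
  obtain p q where pq: "p \<in> underS \<mu> \<alpha>" "q \<in> underS \<mu> \<alpha>" "p \<noteq> q"
    using \<alpha>(2) unfolding bij_betw_def by (metis UNIV_I imageE)
  interpret structure_coding \<kappa> \<mu> K S "e ` arrS" "inv_into arrS e" \<alpha> p q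
    by unfold_locales (use \<alpha>(1) pq bij_betw_inv_into[OF inj_on_imp_bij_betw[OF e]] in auto)
  let ?m = "card_max \<mu> (card_of (Arr A))"
  let ?l = "pow_less ?m \<mu>"
  have m: "Card_order ?m" by (rule Card_order_card_max)
  have "?m <o \<kappa>" unfolding A by (rule card_max_less[OF Card_order_mu card_of_Card_order kappa(5) small_arrS])
  then have lk: "?l <o \<kappa>" by (rule pow_less_small[OF m])
  note mu = card_max_upper(1)[OF Card_order_mu card_of_Card_order, of "Arr A"]
    and nu = card_max_upper(2)[OF Card_order_mu card_of_Card_order, of "Arr A"]
  have ml: "\<mu> \<le>o ?l" by (rule ordLeq_transitive[OF mu pow_less_upper[OF m]])
  have "|Arr A| \<le>o ?l" by (rule ordLeq_transitive[OF nu pow_less_upper[OF m]])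
  then have nl: "|arrS| \<le>o ?l" unfolding A .
  have idem: "pow_less ?l \<mu> =o ?l" by (rule pow_less_idem[OF m mu])
  have LST: "LST_number \<kappa> \<mu> L coded_class le ?l" by (rule LST_coded_class[OF Card_order_pow_less lk idem ml nl])
  \<comment> \<open>\<open>mu_AEC\<close> asks for a Loewenheim-Skolem-Tarski number on the type
    \<open>'u\<close>, whereas \<lambda> lives on a type of sequences; it is copied onto a subset of
    \<open>'u\<close>.\<close>
  obtain X :: "'u set" where X: "|Field ?l| =o |X|"
    using iffD1[OF internalize_card_of_ordLeq
        ordIso_ordLeq_trans[OF card_of_Field_ordIso[OF Card_order_pow_less] ordLess_imp_ordLeq[OF lk]]]
    by blast
  have lX: "?l =o |X|"
    by (rule ordIso_transitive[OF ordIso_symmetric[OF card_of_Field_ordIso[OF Card_order_pow_less]] X])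
  note Xl = ordIso_symmetric[OF lX]
  have "LST_number \<kappa> \<mu> L coded_class le (card_of X)"
    by (rule LST_coded_class[OF card_of_Card_order ordIso_ordLess_trans[OF Xl lk]
        ordIso_transitive[OF pow_less_cong[OF Xl] ordIso_transitive[OF idem lX]]
        ordLeq_ordIso_trans[OF ml lX] ordLeq_ordIso_trans[OF nl lX]])
  then have "mu_AEC \<kappa> \<mu> L coded_class le" by (rule mu_AEC_coded_class)
  then show ?thesis using LST equivalence by blast
qed

end
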